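(* Let $E$ be a vector lattice with the countable sup property, and suppose that $E$ has an order dense ideal $F$ such that $F^\sim_{\mathrm{oc}}$ separates the points of $F$. Let $G$ be a regular vector sublattice of $E$. Then $G$ admits a (necessarily unique) Hausdorff uo-Lebesgue topology $\widehat\tau_G$. For a subset $A$ of $G$, the following seven subsets of $G$ are all equal: (1) $a_{\sigma\widehat\tau_G}(A)$ and $\overline{A}^{\sigma\widehat\tau_G}$; (2) $a_{\sigma\mathrm{uo}}(A)$ and $\overline{A}^{\sigma\mathrm{uo}}$; (3) $a_{\mathrm{uo}}(A)$ and $\overline{A}^{\mathrm{uo}}$; (4) $\overline{A}^{\widehat\tau_G}$. In particular, the $\sigma\widehat\tau_G$-topology, the $\sigma$uo-topology, and the uo-topology on $G$ all coincide with $\widehat\tau_G$.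
   Context: All vector lattices are real and Archimedean. A vector lattice $E$ has the countable sup property if every non-empty subset of $E$ that has a supremum in $E$ has an at most countable subset with the same supremum. A vector sublattice $F$ of $E$ is order dense if for every $x\in E$ with $x>0$ there is $y\in F$ with $0<y\le x$; it is regular if for every net in $F$, $x_\alpha\downarrow 0$ in $F$ implies $x_\alpha\downarrow 0$ in $E$. A net $(x_\alpha)_{\alpha\in\mathcal A}$ in $E$ is order convergent to $x$ if there is a net $(y_\beta)_{\beta\in\mathcal B}$ in $E$ (possibly with a different index set) with $y_\beta\downarrow 0$ such that for every $\beta_0\in\mathcal B$ there is $\alpha_0\in\mathcal A$ with $|x-x_\alpha|\le y_{\beta_0}$ for all $\alpha\ge\alpha_0$; it is unbounded order convergent (uo-convergent) to $x$ if $|x_\alpha-x|\wedge y$ is order convergent to $0$ in $E$ for all $y\in E^+$. $F^\sim_{\mathrm{oc}}$ is the space of order continuous linear functionals on $F$ (those mapping nets order convergent to $0$ to nets convergent to $0$). A uo-Lebesgue topology is a locally solid linear topology (a vector space topology, not necessarily Hausdorff, with a base of solid neighbourhoods of $0$) such that uo-convergence of a net to $x$ implies its topological convergence to $x$. For $A\subseteq G$ (all convergences taken in $G$): $a_{\mathrm{uo}}(A)$ (resp. $a_{\sigma\mathrm{uo}}(A)$) is the set of all uo-limits in $G$ of nets (resp. sequences) in $A$; $A$ is uo-closed (resp. $\sigma$uo-closed) if $a_{\mathrm{uo}}(A)=A$ (resp. $a_{\sigma\mathrm{uo}}(A)=A$). The uo-closed (resp. $\sigma$uo-closed) sets are the closed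 sets of a topology on $G$, the uo-topology (resp. $\sigma$uo-topology), in which the closure of $A$ is written $\overline{A}^{\mathrm{uo}}$ (resp. $\overline{A}^{\sigma\mathrm{uo}}$). For a topology $\tau$ on $G$, $\overline{A}^\tau$ is the $\tau$-closure, $a_{\sigma\tau}(A)$ is the set of all $\tau$-limits of sequences in $A$, $A$ is $\sigma\tau$-closed if $a_{\sigma\tau}(A)=A$, the $\sigma\tau$-closed sets are the closed sets of the $\sigma\tau$-topology, and $\overline{A}^{\sigma\tau}$ is the closure of $A$ in the latter. *)

theory Defs
  imports "HOL-Analysis.Analysis" "HOL-Library.Lattice_Algebras"
begin

section \<open>Archimedean vector lattices\<close>

class vector_lattice = ordered_real_vector + lattice_ab_group_add_abs

class archimedean_vector_lattice = vector_lattice +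
  assumes archimedean: "0 \<le> x \<Longrightarrow> (\<And>n::nat. real n *\<^sub>R x \<le> y) \<Longrightarrow> x = 0"

text \<open>Sublattices are subsets of the ambient type.  Suprema, infima, nets and convergence carry a
  parameter \<open>L\<close>, the vector lattice in which they are taken (\<open>UNIV\<close> for the ambient one).\<close>

definition sup_in :: "'a::order set \<Rightarrow> 'a set \<Rightarrow> 'a \<Rightarrow> bool" where
  "sup_in L S s \<longleftrightarrow> s \<in> L \<and> (\<forall>x\<in>S. x \<le> s) \<and> (\<forall>u\<in>L. (\<forall>x\<in>S. x \<le> u) \<longrightarrow> s \<le> u)"

definition inf_in :: "'a::order set \<Rightarrow> 'a set \<Rightarrow> 'a \<Rightarrow> bool" where
  "inf_in L S s \<longleftrightarrow> s \<in> L \<and> (\<forall>x\<in>S. s \<le> x) \<and> (\<forall>u\<in>L. (\<forall>x\<in>S. u \<le> x) \<longrightarrow> u \<le> s)"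

definition countable_sup_property :: "'a::order set \<Rightarrow> bool" where
  "countable_sup_property L \<longleftrightarrow>
     (\<forall>S s. S \<subseteq> L \<and> S \<noteq> {} \<and> sup_in L S s \<longrightarrow> (\<exists>C. C \<subseteq> S \<and> countable C \<and> sup_in L C s))"

definition vector_sublattice :: "'a::vector_lattice set \<Rightarrow> bool" where
  "vector_sublattice G \<longleftrightarrow> subspace G \<and> (\<forall>x\<in>G. \<forall>y\<in>G. sup x y \<in> G \<and> inf x y \<in> G)"

definition solid_in :: "'a::vector_lattice set \<Rightarrow> 'a set \<Rightarrow> bool" where
  "solid_in L S \<longleftrightarrow> S \<subseteq> L \<and> (\<forall>x\<in>S. \<forall>y\<in>L. \<bar>y\<bar> \<le> \<bar>x\<bar> \<longrightarrow> y \<in> S)"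

definition order_ideal :: "'a::vector_lattice set \<Rightarrow> bool" where
  "order_ideal F \<longleftrightarrow> subspace F \<and> solid_in UNIV F"

definition order_dense :: "'a::vector_lattice set \<Rightarrow> bool" where
  "order_dense F \<longleftrightarrow> (\<forall>x>0. \<exists>y\<in>F. 0 < y \<and> y \<le> x)"

section \<open>Nets\<close>

text \<open>A directed index set is the field of a directed preorder \<open>r\<close>, where \<open>(a, b) \<in> r\<close>
  means that \<open>b\<close> is beyond \<open>a\<close>; a net is a function on the field, its values elsewhere being
  irrelevant.\<close>

definition directed :: "'i rel \<Rightarrow> bool" where
  "directed r \<longleftrightarrow> Field r \<noteq> {} \<and> Preorder r \<and>
     (\<forall>a\<in>Field r. \<forall>b\<in>Field r. \<exists>c. (a, c) \<in> r \<and> (b, c) \<in> r)"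

definition net_in :: "'a set \<Rightarrow> 'i rel \<Rightarrow> ('i \<Rightarrow> 'a) \<Rightarrow> bool" where
  "net_in A r x \<longleftrightarrow> directed r \<and> x ` Field r \<subseteq> A"

definition tails :: "'i rel \<Rightarrow> 'i filter" where
  "tails r = (INF a\<in>Field r. principal (r `` {a}))"

abbreviation nat_le :: "nat rel" where
  "nat_le \<equiv> {(m, n). m \<le> n}"

text \<open>HOL cannot quantify over index types inside a formula.  Nets with values in \<open>'a\<close> that are
  quantified in a definition are indexed by subsets of the following type.  This loses nothing:
  see \<open>net_reindex\<close>, \<open>decreases_to_reindex\<close> and their consequences below.\<close>

type_synonym 'a index = "'a set \<times> 'a"

definition decreases_to :: "'a::order set \<Rightarrow> 'i rel \<Rightarrow> ('i \<Rightarrow> 'a) \<Rightarrow> 'a \<Rightarrow> bool" where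
  "decreases_to L r x l \<longleftrightarrow>
     net_in L r x \<and> (\<forall>(a, b)\<in>r. x b \<le> x a) \<and> inf_in L (x ` Field r) l"

definition order_conv :: "'a::vector_lattice set \<Rightarrow> 'i rel \<Rightarrow> ('i \<Rightarrow> 'a) \<Rightarrow> 'a \<Rightarrow> bool" where
  "order_conv L r x l \<longleftrightarrow> net_in L r x \<and> l \<in> L \<and>
     (\<exists>(s :: 'a index rel) y. decreases_to L s y 0 \<and>
        (\<forall>b\<in>Field s. \<exists>a\<in>Field r. \<forall>c. (a, c) \<in> r \<longrightarrow> \<bar>l - x c\<bar> \<le> y b))"

definition uo_conv :: "'a::vector_lattice set \<Rightarrow> 'i rel \<Rightarrow> ('i \<Rightarrow> 'a) \<Rightarrow> 'a \<Rightarrow> bool" where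
  "uo_conv L r x l \<longleftrightarrow> net_in L r x \<and> l \<in> L \<and>
     (\<forall>y\<in>L. 0 \<le> y \<longrightarrow> order_conv L r (\<lambda>a. inf \<bar>x a - l\<bar> y) 0)"

definition regular_sublattice :: "'a::vector_lattice set \<Rightarrow> bool" where
  "regular_sublattice G \<longleftrightarrow> vector_sublattice G \<and>
     (\<forall>(r :: 'a index rel) x. decreases_to G r x 0 \<longrightarrow> decreases_to UNIV r x 0)"

text \<open>Functionals on \<open>F\<close> are represented by functions on the ambient type; only their
  restrictions to \<open>F\<close> matter.\<close>

definition order_continuous_functional :: "'a::vector_lattice set \<Rightarrow> ('a \<Rightarrow> real) \<Rightarrow> bool" where
  "order_continuous_functional F f \<longleftrightarrow>
     (\<forall>x\<in>F. \<forall>y\<in>F. f (x + y) = f x + f y) \<and> (\<forall>c. \<forall>x\<in>F. f (c *\<^sub>R x) = c * f x) \<and>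
     (\<forall>(r :: 'a index rel) x. order_conv F r x 0 \<longrightarrow> ((\<lambda>a. f (x a)) \<longlongrightarrow> 0) (tails r))"

definition oc_dual_separates_points :: "'a::vector_lattice set \<Rightarrow> bool" where
  "oc_dual_separates_points F \<longleftrightarrow>
     (\<forall>x\<in>F. \<forall>y\<in>F. x \<noteq> y \<longrightarrow> (\<exists>f. order_continuous_functional F f \<and> f x \<noteq> f y))"

section \<open>Topologies\<close>

definition locally_solid_linear_topology :: "'a::vector_lattice set \<Rightarrow> 'a topology \<Rightarrow> bool" where
  "locally_solid_linear_topology G \<tau> \<longleftrightarrow> topspace \<tau> = G \<and>
     continuous_map (prod_topology \<tau> \<tau>) \<tau> (\<lambda>(x, y). x + y) \<and>
     continuous_map (prod_topology euclideanreal \<tau>) \<tau> (\<lambda>(c, x). c *\<^sub>R x) \<and>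
     neighbourhood_base_at 0 (solid_in G) \<tau>"

definition uo_Lebesgue_topology :: "'a::vector_lattice set \<Rightarrow> 'a topology \<Rightarrow> bool" where
  "uo_Lebesgue_topology G \<tau> \<longleftrightarrow> locally_solid_linear_topology G \<tau> \<and>
     (\<forall>(r :: 'a index rel) x l. uo_conv G r x l \<longrightarrow> limitin \<tau> x l (tails r))"

definition Hausdorff_uo_Lebesgue_topology :: "'a::vector_lattice set \<Rightarrow> 'a topology \<Rightarrow> bool" where
  "Hausdorff_uo_Lebesgue_topology G \<tau> \<longleftrightarrow> uo_Lebesgue_topology G \<tau> \<and> Hausdorff_space \<tau>"

definition uo_adh :: "'a::vector_lattice set \<Rightarrow> 'a set \<Rightarrow> 'a set" where
  "uo_adh G A = {l \<in> G. \<exists>(r :: 'a index rel) x. net_in A r x \<and> uo_conv G r x l}"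

definition suo_adh :: "'a::vector_lattice set \<Rightarrow> 'a set \<Rightarrow> 'a set" where
  "suo_adh G A = {l \<in> G. \<exists>x. range x \<subseteq> A \<and> uo_conv G nat_le x l}"

definition seq_adh :: "'a topology \<Rightarrow> 'a set \<Rightarrow> 'a set" where
  "seq_adh \<tau> A = {l \<in> topspace \<tau>. \<exists>x. range x \<subseteq> A \<and> limitin \<tau> x l sequentially}"

text \<open>The topology on \<open>G\<close> whose closed sets are the \<open>C \<subseteq> G\<close> with \<open>adh C = C\<close>.  That it is a
  topology in the three cases used is shown at the end of the theory.\<close>

definition adh_topology :: "'a set \<Rightarrow> ('a set \<Rightarrow> 'a set) \<Rightarrow> 'a topology" where
  "adh_topology G adh = topology (\<lambda>U. U \<subseteq> G \<and> adh (G - U) = G - U)"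

definition uo_topology :: "'a::vector_lattice set \<Rightarrow> 'a topology" where
  "uo_topology G = adh_topology G (uo_adh G)"

definition suo_topology :: "'a::vector_lattice set \<Rightarrow> 'a topology" where
  "suo_topology G = adh_topology G (suo_adh G)"

definition seq_topology :: "'a topology \<Rightarrow> 'a topology" where
  "seq_topology \<tau> = adh_topology (topspace \<tau>) (seq_adh \<tau>)"

section \<open>Independence of the index type\<close>

lemma directed_refl: "directed r \<Longrightarrow> a \<in> Field r \<Longrightarrow> (a, a) \<in> r"
  by (simp add: directed_def preorder_on_def refl_on_def)

lemma directed_trans: "directed r \<Longrightarrow> (a, b) \<in> r \<Longrightarrow> (b, c) \<in> r \<Longrightarrow> (a, c) \<in> r"
  by (meson directed_def preorder_on_def transD)

lemma directed_ub:
  "directed r \<Longrightarrow> a \<in> Field r \<Longrightarrow> b \<in> Field r \<Longrightarrow> \<exists>c. (a, c) \<in> r \<and> (b, c) \<in> r"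
  by (simp add: directed_def)

lemma directedI:
  assumes "I \<noteq> {}" "r \<subseteq> I \<times> I" "\<And>a. a \<in> I \<Longrightarrow> (a, a) \<in> r" "trans r"
    "\<And>a b. a \<in> I \<Longrightarrow> b \<in> I \<Longrightarrow> \<exists>c. (a, c) \<in> r \<and> (b, c) \<in> r"
  shows "directed r" and "Field r = I"
proof -
  show F: "Field r = I" using assms(2,3) by (fastforce simp: Field_def)
  show "directed r"
    unfolding directed_def F preorder_on_def refl_on_def using assms by blast
qed

lemma Field_nat_le [simp]: "Field nat_le = UNIV"
  by (auto simp: Field_def)

lemma directed_nat_le [simp]: "directed nat_le"
  by (rule directedI(1)[of UNIV]) (auto simp: trans_def intro: nat_le_linear, meson nle_le)

lemma eventually_tails:
  assumes "directed r"
  shows "eventually P (tails r) \<longleftrightarrow> (\<exists>a\<in>Field r. \<forall>c. (a, c) \<in> r \<longrightarrow> P c)"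
  unfolding tails_def
proof (subst eventually_INF_base)
  show "Field r \<noteq> {}" using assms by (simp add: directed_def)
  fix a b assume "a \<in> Field r" "b \<in> Field r"
  then obtain c where c: "(a, c) \<in> r" "(b, c) \<in> r" using assms directed_ub by metis
  then have "c \<in> Field r" by (auto simp: Field_def)
  moreover have "r `` {c} \<subseteq> r `` {a} \<inter> r `` {b}"
    using c directed_trans[OF assms] by blast
  ultimately show "\<exists>x\<in>Field r. principal (r `` {x}) \<le> inf (principal (r `` {a})) (principal (r `` {b}))"
    by auto
qed (auto simp: eventually_principal)

lemma tails_nat_le: "tails nat_le = sequentially"
  unfolding filter_eq_iff by (simp add: eventually_tails eventually_sequentially)

lemma net_reindex:
  fixes x :: "'i \<Rightarrow> 'a"
  assumes r: "directed r"
  obtains r' :: "'a index rel" where "directed r'" "snd ` Field r' = x ` Field r"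
    "\<And>P. eventually (\<lambda>i. P (snd i)) (tails r') \<longleftrightarrow> eventually (\<lambda>a. P (x a)) (tails r)"
proof -
  let ?T = "\<lambda>a. x ` (r `` {a})"
  define I where "I = {(S, v). \<exists>a\<in>Field r. S = ?T a \<and> v \<in> S}"
  define r' where "r' = {(i, j). i \<in> I \<and> j \<in> I \<and> fst j \<subseteq> fst i}"
  have F: "b \<in> Field r" if "(a, b) \<in> r" for a b using that by (auto simp: Field_def)
  have self: "x a \<in> ?T a" if "a \<in> Field r" for a using directed_refl[OF r that] by blast
  have anti: "?T c \<subseteq> ?T a" if "(a, c) \<in> r" for a c using directed_trans[OF r that] by blast
  have "I \<noteq> {}" using r self unfolding I_def directed_def by fastforce
  moreover have "\<exists>k. (i, k) \<in> r' \<and> (j, k) \<in> r'" if i: "i \<in> I" and j: "j \<in> I" for i j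
  proof -
    obtain a b where ab: "a \<in> Field r" "b \<in> Field r" "fst i = ?T a" "fst j = ?T b"
      using i j by (auto simp: I_def)
    then obtain c where c: "(a, c) \<in> r" "(b, c) \<in> r" using directed_ub[OF r] by metis
    have "(?T c, x c) \<in> I" using self F c by (auto simp: I_def)
    then show ?thesis using i j ab anti[OF c(1)] anti[OF c(2)]
      by (intro exI[of _ "(?T c, x c)"]) (simp add: r'_def)
  qed
  moreover have "r' \<subseteq> I \<times> I" "\<And>i. i \<in> I \<Longrightarrow> (i, i) \<in> r'" "trans r'"
    by (auto simp: r'_def trans_def)
  ultimately have d: "directed r'" "Field r' = I" using directedI[of I r'] by metis+
  show ?thesis
  proof
    show "directed r'" by fact
    show "snd ` Field r' = x ` Field r"
    proof
      show "snd ` Field r' \<subseteq> x ` Field r" using F d by (auto simp: I_def)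
      show "x ` Field r \<subseteq> snd ` Field r'"
      proof (clarify)
        fix a assume "a \<in> Field r"
        then have "(?T a, x a) \<in> I" using self by (auto simp: I_def)
        then show "x a \<in> snd ` Field r'" unfolding d by force
      qed
    qed
    show "eventually (\<lambda>i. P (snd i)) (tails r') \<longleftrightarrow> eventually (\<lambda>a. P (x a)) (tails r)" for P
      unfolding eventually_tails[OF r] eventually_tails[OF d(1)]
    proof
      assume "\<exists>i\<in>Field r'. \<forall>c. (i, c) \<in> r' \<longrightarrow> P (snd c)"
      then obtain i where i: "i \<in> I" "\<And>c. (i, c) \<in> r' \<Longrightarrow> P (snd c)" using d by auto
      then obtain a where a: "a \<in> Field r" "fst i = ?T a" by (auto simp: I_def)
      have "P (x c)" if "(a, c) \<in> r" for c
      proof -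
        have "(?T a, x c) \<in> I" using that a by (auto simp: I_def)
        then show ?thesis using i(2)[of "(?T a, x c)"] i(1) a by (simp add: r'_def)
      qed
      then show "\<exists>a\<in>Field r. \<forall>c. (a, c) \<in> r \<longrightarrow> P (x c)" using a by blast
    next
      assume "\<exists>a\<in>Field r. \<forall>c. (a, c) \<in> r \<longrightarrow> P (x c)"
      then obtain a where a: "a \<in> Field r" "\<forall>c. (a, c) \<in> r \<longrightarrow> P (x c)" by blast
      have i: "(?T a, x a) \<in> I" using a self by (auto simp: I_def)
      have "P (snd c)" if "((?T a, x a), c) \<in> r'" for c
      proof -
        have "snd c \<in> ?T a" using that by (auto simp: r'_def I_def)
        then show ?thesis using a by auto
      qed
      then show "\<exists>i\<in>Field r'. \<forall>c. (i, c) \<in> r' \<longrightarrow> P (snd c)" using i d by blast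
    qed
  qed
qed

lemma decreases_to_reindex:
  fixes x :: "'i \<Rightarrow> 'a::order"
  assumes x: "decreases_to L r x l"
  obtains s :: "'a index rel" where "decreases_to L s snd l" "snd ` Field s = x ` Field r"
proof -
  have r: "directed r" and mono: "\<And>a b. (a, b) \<in> r \<Longrightarrow> x b \<le> x a"
    using x by (auto simp: decreases_to_def net_in_def)
  define I where "I = {({} :: 'a set, v) | v. v \<in> x ` Field r}"
  define s where "s = {(i, j). i \<in> I \<and> j \<in> I \<and> snd j \<le> snd i}"
  have "I \<noteq> {}" using r unfolding I_def directed_def by auto
  moreover have "\<exists>k. (i, k) \<in> s \<and> (j, k) \<in> s" if i: "i \<in> I" and j: "j \<in> I" for i j
  proof -
    obtain a b where ab: "a \<in> Field r" "b \<in> Field r" "snd i = x a" "snd j = x b"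
      using i j by (auto simp: I_def)
    then obtain c where c: "(a, c) \<in> r" "(b, c) \<in> r" using directed_ub[OF r] by metis
    then have "c \<in> Field r" by (auto simp: Field_def)
    then have "({}, x c) \<in> I" by (auto simp: I_def)
    then show ?thesis using i j ab mono[OF c(1)] mono[OF c(2)]
      by (intro exI[of _ "({}, x c)"]) (simp add: s_def)
  qed
  moreover have "s \<subseteq> I \<times> I" "\<And>i. i \<in> I \<Longrightarrow> (i, i) \<in> s" "trans s"
    by (auto simp: s_def trans_def)
  ultimately have d: "directed s" "Field s = I" using directedI[of I s] by metis+
  have im: "snd ` Field s = x ` Field r" unfolding d I_def by force
  moreover have "decreases_to L s snd l"
    using x d unfolding decreases_to_def net_in_def im by (auto simp: s_def)
  ultimately show thesis using that by blast
qed

lemma order_convI_any_index: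
  fixes y :: "'j \<Rightarrow> 'a::vector_lattice"
  assumes "net_in L r x" "l \<in> L" and y: "decreases_to L s y 0"
    and dom: "\<And>b. b \<in> Field s \<Longrightarrow> \<exists>a\<in>Field r. \<forall>c. (a, c) \<in> r \<longrightarrow> \<bar>l - x c\<bar> \<le> y b"
  shows "order_conv L r x l"
proof -
  obtain s' :: "'a index rel" where s': "decreases_to L s' snd 0" "snd ` Field s' = y ` Field s"
    using decreases_to_reindex[OF y] by blast
  have "\<exists>a\<in>Field r. \<forall>c. (a, c) \<in> r \<longrightarrow> \<bar>l - x c\<bar> \<le> snd b" if "b \<in> Field s'" for b
  proof -
    have "snd b \<in> y ` Field s" using s'(2) that by blast
    then show ?thesis using dom by auto
  qed
  then show ?thesis using assms(1,2) s'(1) unfolding order_conv_def by blast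
qed

lemma order_conv_reindex:
  fixes x :: "'i \<Rightarrow> 'a::vector_lattice"
  assumes "directed r" "directed r'" and im: "x' ` Field r' = x ` Field r"
    and ev: "\<And>P. eventually (\<lambda>i. P (x' i)) (tails r') \<longleftrightarrow> eventually (\<lambda>a. P (x a)) (tails r)"
  shows "order_conv L r' (\<lambda>i. h (x' i)) l \<longleftrightarrow> order_conv L r (\<lambda>i. h (x i)) l"
proof -
  have "(\<lambda>i. h (x' i)) ` Field r' = (\<lambda>i. h (x i)) ` Field r"
    using arg_cong[OF im, of "image h"] by (simp add: image_image)
  then have "net_in L r' (\<lambda>i. h (x' i)) \<longleftrightarrow> net_in L r (\<lambda>i. h (x i))"
    using assms(1,2) by (simp add: net_in_def)
  moreover have "(\<exists>a\<in>Field r'. \<forall>c. (a, c) \<in> r' \<longrightarrow> \<bar>l - h (x' c)\<bar> \<le> z) \<longleftrightarrow>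
      (\<exists>a\<in>Field r. \<forall>c. (a, c) \<in> r \<longrightarrow> \<bar>l - h (x c)\<bar> \<le> z)" for z
    using ev[of "\<lambda>v. \<bar>l - h v\<bar> \<le> z"] assms(1,2) by (simp add: eventually_tails)
  ultimately show ?thesis unfolding order_conv_def by simp
qed

lemma uo_conv_reindex:
  fixes x :: "'i \<Rightarrow> 'a::vector_lattice"
  assumes "directed r" "directed r'" and im: "x' ` Field r' = x ` Field r"
    and ev: "\<And>P. eventually (\<lambda>i. P (x' i)) (tails r') \<longleftrightarrow> eventually (\<lambda>a. P (x a)) (tails r)"
  shows "uo_conv L r' x' l \<longleftrightarrow> uo_conv L r x l"
  unfolding uo_conv_def using order_conv_reindex[OF assms(1,2) im ev, where h="\<lambda>v. inf \<bar>v - l\<bar> _"]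
  by (simp add: net_in_def assms(1,2) im)

lemma uo_adh_any_index:
  fixes x :: "'i \<Rightarrow> 'a::vector_lattice"
  assumes "net_in A r x" "uo_conv G r x l"
  shows "l \<in> uo_adh G A"
proof -
  have r: "directed r" using assms(1) by (simp add: net_in_def)
  obtain r' :: "'a index rel" where r': "directed r'" "snd ` Field r' = x ` Field r"
    "\<And>P. eventually (\<lambda>i. P (snd i)) (tails r') \<longleftrightarrow> eventually (\<lambda>a. P (x a)) (tails r)"
    using net_reindex[OF r] by blast
  have "uo_conv G r' snd l" using uo_conv_reindex[OF r r'] assms(2) by blast
  moreover have "net_in A r' snd" using assms(1) r' by (simp add: net_in_def)
  ultimately show ?thesis unfolding uo_adh_def uo_conv_def by blast
qed

lemma uo_Lebesgue_any_index:
  fixes x :: "'i \<Rightarrow> 'a::vector_lattice"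
  assumes "uo_Lebesgue_topology G \<tau>" "uo_conv G r x l"
  shows "limitin \<tau> x l (tails r)"
proof -
  have r: "directed r" using assms(2) by (simp add: uo_conv_def net_in_def)
  obtain r' :: "'a index rel" where r': "directed r'" "snd ` Field r' = x ` Field r"
    "\<And>P. eventually (\<lambda>i. P (snd i)) (tails r') \<longleftrightarrow> eventually (\<lambda>a. P (x a)) (tails r)"
    using net_reindex[OF r] by blast
  have "uo_conv G r' snd l" using uo_conv_reindex[OF r r'] assms(2) by blast
  then have "limitin \<tau> snd l (tails r')" using assms(1) unfolding uo_Lebesgue_topology_def by blast
  then show ?thesis unfolding limitin_def using r'(3)[of "\<lambda>v. v \<in> _"] by simp
qed

lemma order_continuous_functional_any_index:
  fixes x :: "'i \<Rightarrow> 'a::vector_lattice"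
  assumes "order_continuous_functional F f" "order_conv F r x 0"
  shows "((\<lambda>a. f (x a)) \<longlongrightarrow> 0) (tails r)"
proof -
  have r: "directed r" using assms(2) by (simp add: order_conv_def net_in_def)
  obtain r' :: "'a index rel" where r': "directed r'" "snd ` Field r' = x ` Field r"
    "\<And>P. eventually (\<lambda>i. P (snd i)) (tails r') \<longleftrightarrow> eventually (\<lambda>a. P (x a)) (tails r)"
    using net_reindex[OF r] by blast
  have "order_conv F r' snd 0"
    using order_conv_reindex[OF r r', where h="\<lambda>v. v"] assms(2) by simp
  then have "((\<lambda>a. f (snd a)) \<longlongrightarrow> 0) (tails r')"
    using assms(1) unfolding order_continuous_functional_def by blast
  then show ?thesis unfolding tendsto_def using r'(3)[of "\<lambda>v. f v \<in> _"] by simp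
qed

lemma regular_sublattice_any_index:
  fixes x :: "'i \<Rightarrow> 'a::vector_lattice"
  assumes "regular_sublattice G" "decreases_to G r x 0"
  shows "decreases_to UNIV r x 0"
proof -
  obtain s :: "'a index rel" where s: "decreases_to G s snd 0" "snd ` Field s = x ` Field r"
    using decreases_to_reindex[OF assms(2)] by blast
  have "decreases_to UNIV s snd 0" using assms(1) s(1) unfolding regular_sublattice_def by blast
  then show ?thesis using assms(2) s(2) by (simp add: decreases_to_def net_in_def)
qed

section \<open>The closed sets of \<open>uo_topology\<close>, \<open>suo_topology\<close> and \<open>seq_topology\<close>\<close>

lemma closedin_adh_topology:
  assumes sub: "\<And>A. A \<subseteq> G \<Longrightarrow> adh A \<subseteq> G" and empty: "adh {} = {}"
    and ext: "\<And>A. A \<subseteq> G \<Longrightarrow> A \<subseteq> adh A"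
    and mono: "\<And>A B. A \<subseteq> B \<Longrightarrow> B \<subseteq> G \<Longrightarrow> adh A \<subseteq> adh B"
    and un: "\<And>A B. A \<subseteq> G \<Longrightarrow> B \<subseteq> G \<Longrightarrow> adh (A \<union> B) \<subseteq> adh A \<union> adh B"
  shows "closedin (adh_topology G adh) C \<longleftrightarrow> C \<subseteq> G \<and> adh C = C"
    and "topspace (adh_topology G adh) = G"
proof -
  have "istopology (\<lambda>U. U \<subseteq> G \<and> adh (G - U) = G - U)"
    unfolding istopology_def
  proof (intro conjI allI impI)
    fix S T assume S: "S \<subseteq> G \<and> adh (G - S) = G - S" and T: "T \<subseteq> G \<and> adh (G - T) = G - T"
    show "S \<inter> T \<subseteq> G" using S by blast
    have "adh (G - S \<inter> T) \<subseteq> G - S \<inter> T"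
      using un[of "G - S" "G - T"] S T by (auto simp: Diff_Int)
    then show "adh (G - S \<inter> T) = G - S \<inter> T" using ext[of "G - S \<inter> T"] by blast
  next
    fix K assume K: "\<forall>S\<in>K. S \<subseteq> G \<and> adh (G - S) = G - S"
    then show "\<Union>K \<subseteq> G" by blast
    have "adh (G - \<Union>K) \<subseteq> G - S" if "S \<in> K" for S
      using mono[of "G - \<Union>K" "G - S"] K that by blast
    then have "adh (G - \<Union>K) \<subseteq> G - \<Union>K" using sub[of "G - \<Union>K"] by blast
    then show "adh (G - \<Union>K) = G - \<Union>K" using ext[of "G - \<Union>K"] by blast
  qed
  then have op: "openin (adh_topology G adh) U \<longleftrightarrow> U \<subseteq> G \<and> adh (G - U) = G - U" for U
    unfolding adh_topology_def by (simp add: topology_inverse')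
  then show top: "topspace (adh_topology G adh) = G"
    unfolding topspace_def using empty by (auto intro!: exI[of _ G])
  show "closedin (adh_topology G adh) C \<longleftrightarrow> C \<subseteq> G \<and> adh C = C"
    unfolding closedin_def top op by (auto simp: double_diff)
qed

lemma order_conv_subnet:
  assumes x: "order_conv L r x l" and x': "net_in L r' x'"
    and sn: "\<And>a. a \<in> Field r \<Longrightarrow> \<exists>a'\<in>Field r'. \<forall>c. (a', c) \<in> r' \<longrightarrow> (\<exists>b. (a, b) \<in> r \<and> x' c = x b)"
  shows "order_conv L r' x' l"
proof -
  have "\<exists>a'\<in>Field r'. \<forall>c. (a', c) \<in> r' \<longrightarrow> \<bar>l - x' c\<bar> \<le> z"
    if z: "\<exists>a\<in>Field r. \<forall>c. (a, c) \<in> r \<longrightarrow> \<bar>l - x c\<bar> \<le> z" for z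
  proof -
    obtain a where a: "a \<in> Field r" "\<And>c. (a, c) \<in> r \<Longrightarrow> \<bar>l - x c\<bar> \<le> z" using z by blast
    then show ?thesis using sn[OF a(1)] by metis
  qed
  then show ?thesis using x x' unfolding order_conv_def by blast
qed

lemma uo_conv_subnet:
  assumes x: "uo_conv L r x l" and r': "directed r'"
    and range: "\<And>c. c \<in> Field r' \<Longrightarrow> f c \<in> Field r"
    and sn: "\<And>a. a \<in> Field r \<Longrightarrow> \<exists>a'\<in>Field r'. \<forall>c. (a', c) \<in> r' \<longrightarrow> (a, f c) \<in> r"
  shows "uo_conv L r' (x \<circ> f) l"
proof -
  have "order_conv L r' (\<lambda>c. inf \<bar>(x \<circ> f) c - l\<bar> y) 0"
    if y: "order_conv L r (\<lambda>a. inf \<bar>x a - l\<bar> y) 0" for y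
  proof (rule order_conv_subnet[OF y])
    show "net_in L r' (\<lambda>c. inf \<bar>(x \<circ> f) c - l\<bar> y)"
      using y r' range by (auto simp: net_in_def order_conv_def)
  qed (use sn in fastforce)
  moreover have "net_in L r' (x \<circ> f)" using x r' range by (auto simp: net_in_def uo_conv_def)
  ultimately show ?thesis using x unfolding uo_conv_def by blast
qed

lemma uo_conv_const:
  assumes "vector_sublattice G" "l \<in> G" "directed r"
  shows "uo_conv G r (\<lambda>_. l) l"
proof -
  have 0: "0 \<in> G" using assms(1) by (simp add: vector_sublattice_def subspace_0)
  have "decreases_to G nat_le (\<lambda>_. 0) 0"
    using 0 by (auto simp: decreases_to_def net_in_def inf_in_def)
  then have "order_conv G r (\<lambda>_. 0) 0"
    using 0 assms by (intro order_convI_any_index[where s=nat_le]) (auto simp: net_in_def directed_def)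
  then show ?thesis using assms by (auto simp: uo_conv_def net_in_def inf_absorb1)
qed

lemma closedin_uo_topology:
  assumes G: "vector_sublattice G"
  shows "closedin (uo_topology G) C \<longleftrightarrow> C \<subseteq> G \<and> uo_adh G C = C"
    and "topspace (uo_topology G) = G"
proof -
  have ne: "Field r \<noteq> {}" if "directed r" for r :: "'a index rel"
    using that by (simp add: directed_def)
  have 1: "uo_adh G A \<subseteq> G" if "A \<subseteq> G" for A by (auto simp: uo_adh_def)
  have 2: "uo_adh G {} = {}" using ne by (fastforce simp: uo_adh_def net_in_def)
  have 3: "A \<subseteq> uo_adh G A" if "A \<subseteq> G" for A
  proof
    fix l assume l: "l \<in> A"
    then show "l \<in> uo_adh G A"
      using that uo_conv_const[OF G _ directed_nat_le, of l]
      by (intro uo_adh_any_index[of _ nat_le "\<lambda>_. l"]) (auto simp: net_in_def)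
  qed
  have 4: "uo_adh G A \<subseteq> uo_adh G B" if "A \<subseteq> B" "B \<subseteq> G" for A B
    using that(1) unfolding uo_adh_def net_in_def by blast
  have 5: "uo_adh G (A \<union> B) \<subseteq> uo_adh G A \<union> uo_adh G B" if "A \<subseteq> G" "B \<subseteq> G" for A B
  proof
    fix l assume "l \<in> uo_adh G (A \<union> B)"
    then obtain r :: "'a index rel" and x where
      r: "directed r" and x: "x ` Field r \<subseteq> A \<union> B" and c: "uo_conv G r x l"
      by (auto simp: uo_adh_def net_in_def)
    have key: "l \<in> uo_adh G D"
      if J: "J = {a \<in> Field r. x a \<in> D}" and cof: "\<And>a. a \<in> Field r \<Longrightarrow> \<exists>b\<in>J. (a, b) \<in> r" for J D
    proof -
      let ?r = "r \<inter> J \<times> J"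
      have ub: "\<exists>c. (a, c) \<in> ?r \<and> (b, c) \<in> ?r" if "a \<in> J" "b \<in> J" for a b
      proof -
        obtain d where d: "(a, d) \<in> r" "(b, d) \<in> r" using directed_ub[OF r] J \<open>a \<in> J\<close> \<open>b \<in> J\<close> by blast
        then have "d \<in> Field r" by (auto simp: Field_def)
        then obtain e where "e \<in> J" "(d, e) \<in> r" using cof by blast
        then show ?thesis using d that directed_trans[OF r] by blast
      qed
      have "J \<noteq> {}" using cof ne[OF r] by blast
      moreover have "(a, a) \<in> ?r" if "a \<in> J" for a using that J directed_refl[OF r] by blast
      moreover have "trans ?r" using directed_trans[OF r] unfolding trans_def by blast
      ultimately have d: "directed ?r" "Field ?r = J"
        using ub directedI[of J ?r] by (metis Int_lower2)+
      have "uo_conv G ?r (x \<circ> id) l"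
      proof (rule uo_conv_subnet[OF c d(1)])
        fix a assume "a \<in> Field r"
        then obtain b where b: "b \<in> J" "(a, b) \<in> r" using cof by blast
        then show "\<exists>a'\<in>Field ?r. \<forall>c. (a', c) \<in> ?r \<longrightarrow> (a, id c) \<in> r"
          unfolding d(2) using directed_trans[OF r b(2)] by auto
      qed (use d J in auto)
      moreover have "net_in D ?r (x \<circ> id)" using d J by (auto simp: net_in_def)
      ultimately show ?thesis by (rule uo_adh_any_index[rotated])
    qed
    show "l \<in> uo_adh G A \<union> uo_adh G B"
    proof (cases "\<forall>a\<in>Field r. \<exists>b\<in>{a \<in> Field r. x a \<in> A}. (a, b) \<in> r")
      case True
      then show ?thesis using key[OF refl, of A] by blast
    next
      case False
      then obtain a where a: "a \<in> Field r" "\<And>b. (a, b) \<in> r \<Longrightarrow> x b \<notin> A"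
        using FieldI2 by fast
      have "\<exists>d\<in>{a \<in> Field r. x a \<in> B}. (b, d) \<in> r" if b: "b \<in> Field r" for b
      proof -
        obtain d where d: "(a, d) \<in> r" "(b, d) \<in> r" using directed_ub[OF r a(1) b] by blast
        then have "d \<in> Field r" by (auto simp: Field_def)
        then show ?thesis using d a(2)[OF d(1)] x by blast
      qed
      then show ?thesis using key[OF refl, of B] by blast
    qed
  qed
  show "closedin (uo_topology G) C \<longleftrightarrow> C \<subseteq> G \<and> uo_adh G C = C" "topspace (uo_topology G) = G"
    unfolding uo_topology_def by (rule closedin_adh_topology; fact 1 2 3 4 5)+
qed

lemma subsequence_in_union:
  fixes x :: "nat \<Rightarrow> 'a"
  assumes "range x \<subseteq> A \<union> B"
  obtains f :: "nat \<Rightarrow> nat" where "strict_mono f" "range (x \<circ> f) \<subseteq> A \<or> range (x \<circ> f) \<subseteq> B"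
proof -
  have "UNIV = {n. x n \<in> A} \<union> {n. x n \<in> B}" using assms by blast
  then have "infinite {n. x n \<in> A} \<or> infinite {n. x n \<in> B}"
    by (metis finite_Un infinite_UNIV_nat)
  then show thesis
  proof
    assume "infinite {n. x n \<in> A}"
    then show thesis using infinite_enumerate[of "{n. x n \<in> A}"] that by fastforce
  next
    assume "infinite {n. x n \<in> B}"
    then show thesis using infinite_enumerate[of "{n. x n \<in> B}"] that by fastforce
  qed
qed

lemma closedin_suo_topology:
  assumes G: "vector_sublattice G"
  shows "closedin (suo_topology G) C \<longleftrightarrow> C \<subseteq> G \<and> suo_adh G C = C"
    and "topspace (suo_topology G) = G"
proof -
  have 1: "suo_adh G A \<subseteq> G" if "A \<subseteq> G" for A by (auto simp: suo_adh_def)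
  have 2: "suo_adh G {} = {}" by (auto simp: suo_adh_def)
  have 3: "A \<subseteq> suo_adh G A" if "A \<subseteq> G" for A
  proof
    fix l assume "l \<in> A"
    then have "range (\<lambda>_::nat. l) \<subseteq> A \<and> uo_conv G nat_le (\<lambda>_. l) l"
      using that uo_conv_const[OF G _ directed_nat_le, of l] by auto
    then show "l \<in> suo_adh G A" using that \<open>l \<in> A\<close> unfolding suo_adh_def by blast
  qed
  have 4: "suo_adh G A \<subseteq> suo_adh G B" if "A \<subseteq> B" "B \<subseteq> G" for A B
    using that(1) unfolding suo_adh_def by blast
  have 5: "suo_adh G (A \<union> B) \<subseteq> suo_adh G A \<union> suo_adh G B" if "A \<subseteq> G" "B \<subseteq> G" for A B
  proof
    fix l assume "l \<in> suo_adh G (A \<union> B)"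
    then obtain x where x: "l \<in> G" "range x \<subseteq> A \<union> B" "uo_conv G nat_le x l"
      by (auto simp: suo_adh_def)
    obtain f :: "nat \<Rightarrow> nat" where f: "strict_mono f" "range (x \<circ> f) \<subseteq> A \<or> range (x \<circ> f) \<subseteq> B"
      using subsequence_in_union[OF x(2)] by blast
    have "uo_conv G nat_le (x \<circ> f) l"
    proof (rule uo_conv_subnet[OF x(3)])
      fix a :: nat
      have "a \<le> f c" if "a \<le> c" for c
        using strict_mono_imp_increasing[OF f(1), of c] that by simp
      then show "\<exists>a'\<in>Field nat_le. \<forall>c. (a', c) \<in> nat_le \<longrightarrow> (a, f c) \<in> nat_le"
        by (intro bexI[of _ a]) auto
    qed auto
    then show "l \<in> suo_adh G A \<union> suo_adh G B" using x(1) f(2) unfolding suo_adh_def by blast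
  qed
  show "closedin (suo_topology G) C \<longleftrightarrow> C \<subseteq> G \<and> suo_adh G C = C" "topspace (suo_topology G) = G"
    unfolding suo_topology_def by (rule closedin_adh_topology; fact 1 2 3 4 5)+
qed

lemma closedin_seq_topology:
  shows "closedin (seq_topology \<tau>) C \<longleftrightarrow> C \<subseteq> topspace \<tau> \<and> seq_adh \<tau> C = C"
    and "topspace (seq_topology \<tau>) = topspace \<tau>"
proof -
  have 1: "seq_adh \<tau> A \<subseteq> topspace \<tau>" if "A \<subseteq> topspace \<tau>" for A by (auto simp: seq_adh_def)
  have 2: "seq_adh \<tau> {} = {}" by (auto simp: seq_adh_def)
  have 3: "A \<subseteq> seq_adh \<tau> A" if "A \<subseteq> topspace \<tau>" for A
  proof
    fix l assume "l \<in> A"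
    then have "range (\<lambda>_::nat. l) \<subseteq> A \<and> limitin \<tau> (\<lambda>_. l) l sequentially"
      using that by (auto simp: limitin_def)
    then show "l \<in> seq_adh \<tau> A" using that \<open>l \<in> A\<close> unfolding seq_adh_def by blast
  qed
  have 4: "seq_adh \<tau> A \<subseteq> seq_adh \<tau> B" if "A \<subseteq> B" "B \<subseteq> topspace \<tau>" for A B
    using that(1) unfolding seq_adh_def by blast
  have 5: "seq_adh \<tau> (A \<union> B) \<subseteq> seq_adh \<tau> A \<union> seq_adh \<tau> B" if "A \<subseteq> topspace \<tau>" "B \<subseteq> topspace \<tau>" for A B
  proof
    fix l assume "l \<in> seq_adh \<tau> (A \<union> B)"
    then obtain x where x: "l \<in> topspace \<tau>" "range x \<subseteq> A \<union> B" "limitin \<tau> x l sequentially"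
      by (auto simp: seq_adh_def)
    obtain f :: "nat \<Rightarrow> nat" where f: "strict_mono f" "range (x \<circ> f) \<subseteq> A \<or> range (x \<circ> f) \<subseteq> B"
      using subsequence_in_union[OF x(2)] by blast
    have "limitin \<tau> (x \<circ> f) l sequentially" using limitin_subsequence[OF f(1) x(3)] .
    then show "l \<in> seq_adh \<tau> A \<union> seq_adh \<tau> B" using x(1) f(2) unfolding seq_adh_def by blast
  qed
  show "closedin (seq_topology \<tau>) C \<longleftrightarrow> C \<subseteq> topspace \<tau> \<and> seq_adh \<tau> C = C"
    "topspace (seq_topology \<tau>) = topspace \<tau>"
    unfolding seq_topology_def by (rule closedin_adh_topology; fact 1 2 3 4 5)+
qed

end

theory Submission
  imports Defs
begin

text \<open>Let \<open>\<tau>\<close> be a Hausdorff uo-Lebesgue topology on \<open>G\<close>.  A sequence \<open>V\<close> of solid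
  neighbourhoods of \<open>0\<close> with \<open>V (n + 1) + V (n + 1) \<subseteq> V n\<close> has as intersection a
  \<open>\<tau>\<close>-closed ideal, and by the countable sup property every \<open>z \<ge> 0\<close> admits such a sequence whose
  intersection is disjoint from \<open>z\<close>.  For \<open>l\<close> in the \<open>\<tau>\<close>-closure of \<open>A\<close> choose
  \<open>x n \<in> A\<close> inductively such that \<open>x n - l\<close> lies in the \<open>n\<close>-th neighbourhoods belonging
  to all \<open>\<bar>x k - l\<bar>\<close> with \<open>k < n\<close>.  The tails of \<open>\<Sum>\<bar>x n - l\<bar>\<close> are then small, and an element below
  all eventual upper bounds of \<open>inf \<bar>x n - l\<bar> y\<close> is disjoint from every
  \<open>\<bar>x n - l\<bar>\<close>, hence \<open>0\<close>.  So \<open>x\<close> uo-converges to \<open>l\<close>.  This gives all equalities, and also uniqueness,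
  since \<open>uo_topology G\<close> does not depend on \<open>\<tau>\<close>.

  For existence, take the topology given by the pseudonorms \<open>x \<mapsto> sup {\<bar>f v\<bar> | \<bar>v\<bar> \<le> inf \<bar>x\<bar> u}\<close> with \<open>f\<close> an order
  continuous functional on \<open>F\<close> and \<open>0 \<le> u \<in> F\<close>.\<close>

section \<open>Vector lattices and decreasing sets\<close>

lemma inf_add_le:
  fixes a b c :: "'a::vector_lattice"
  assumes "0 \<le> a" "0 \<le> b" "0 \<le> c"
  shows "inf c (a + b) \<le> inf c a + inf c b"
proof -
  have "inf c (a + b) \<le> inf c a + b"
    unfolding add_inf_distrib_right using assms by (simp add: le_infI1 add_increasing2)
  moreover have "inf c (a + b) \<le> inf c a + c"
    unfolding add_inf_distrib_right using assms by (simp add: le_infI1 add_increasing add_increasing2)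
  ultimately show ?thesis by (simp add: add_inf_distrib_left)
qed

lemma disjoint_add:
  fixes a b c :: "'a::vector_lattice"
  assumes "0 \<le> a" "0 \<le> b" "0 \<le> c" "inf c a = 0" "inf c b = 0"
  shows "inf c (a + b) = 0"
  using inf_add_le[OF assms(1-3)] assms by (simp add: order_antisym)

lemma Riesz_decomposition:
  fixes v a b :: "'a::vector_lattice"
  assumes "\<bar>v\<bar> \<le> a + b" "0 \<le> a" "0 \<le> b"
  obtains v1 v2 where "v = v1 + v2" "\<bar>v1\<bar> \<le> a" "\<bar>v2\<bar> \<le> b"
proof
  \<comment> \<open>The first summand is \<open>v\<close> truncated to the order interval from
    \<open>- a\<close> to \<open>a\<close>.\<close>
  let ?w = "sup (- a) (inf v a)"
  show "v = ?w + (v - ?w)" by (subst add.commute) (rule diff_add_cancel[symmetric])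
  have "- a \<le> a" using assms(2) by (simp add: minus_le_self_iff)
  then show "\<bar>?w\<bar> \<le> a"
    by (intro abs_leI) (auto simp: minus_le_iff simp del: neg_sup_eq_inf)
  have v: "v \<le> a + b" "- v \<le> a + b" using assms(1) by (auto intro: order_trans abs_ge_self abs_ge_minus_self)
  show "\<bar>v - ?w\<bar> \<le> b"
  proof (rule abs_leI)
    have "v - b \<le> inf v a" using v assms by (simp add: algebra_simps)
    then have "v - b \<le> ?w" by (rule le_supI2)
    then show "v - ?w \<le> b" by (simp only: diff_le_eq add.commute)
    have "- a \<le> v + b" using v(2) using minus_le_iff[of v "a + b"] by (simp add: algebra_simps)
    moreover have "inf v a \<le> v + b" using assms(3) by (intro le_infI1) simp
    ultimately have "?w \<le> v + b" by (rule le_supI)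
    then show "- (v - ?w) \<le> b" by (simp only: minus_diff_eq diff_le_eq add.commute)
  qed
qed

lemma inf_abs_add_le:
  fixes x y u :: "'a::vector_lattice"
  assumes "0 \<le> u"
  shows "inf \<bar>x + y\<bar> u \<le> inf \<bar>x\<bar> u + inf \<bar>y\<bar> u"
proof -
  have "inf u \<bar>x + y\<bar> \<le> inf u (\<bar>x\<bar> + \<bar>y\<bar>)" using abs_triangle_ineq[of x y] by (simp add: le_infI2)
  also have "\<dots> \<le> inf u \<bar>x\<bar> + inf u \<bar>y\<bar>" by (rule inf_add_le) (use assms in auto)
  finally show ?thesis by (simp add: inf_commute)
qed

text \<open>A rearrangement of \<open>a + c = inf a c + sup a c\<close>. It turns what a truncation
  at \<open>c\<close> cuts off into a difference that can be compared with \<open>b - c\<close> for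
  an upper bound \<open>b\<close> of \<open>a\<close> and \<open>c\<close>.\<close>

lemma diff_inf_eq_sup_diff: "a - inf a c = sup a c - (c :: 'a::vector_lattice)"
proof -
  have "a - i = s - c" if "a + c = s + i" for i s using that by (simp add: algebra_simps)
  then show ?thesis using add_eq_inf_sup[of a c] by blast
qed

lemma abs_scaleR_nonneg:
  fixes x :: "'a::vector_lattice"
  assumes "0 \<le> c"
  shows "\<bar>c *\<^sub>R x\<bar> \<le> c *\<^sub>R \<bar>x\<bar>"
  by (rule abs_leI) (use assms scaleR_left_mono[of x "\<bar>x\<bar>" c] scaleR_left_mono[of "- x" "\<bar>x\<bar>" c] in \<open>auto simp: abs_ge_self abs_ge_minus_self\<close>)

lemma abs_scaleR_le:
  fixes x :: "'a::vector_lattice"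
  shows "\<bar>c *\<^sub>R x\<bar> \<le> \<bar>c\<bar> *\<^sub>R \<bar>x\<bar>"
  using abs_scaleR_nonneg[of "\<bar>c\<bar>" x] by (cases "0 \<le> c") auto

section \<open>Sublattices and downward directed sets with infimum 0\<close>

lemma vector_sublatticeD:
  assumes "vector_sublattice G"
  shows "0 \<in> G" "\<And>x y. x \<in> G \<Longrightarrow> y \<in> G \<Longrightarrow> x + y \<in> G" "\<And>x y. x \<in> G \<Longrightarrow> y \<in> G \<Longrightarrow> x - y \<in> G"
    "\<And>x c. x \<in> G \<Longrightarrow> c *\<^sub>R x \<in> G" "\<And>x. x \<in> G \<Longrightarrow> - x \<in> G"
    "\<And>x y. x \<in> G \<Longrightarrow> y \<in> G \<Longrightarrow> sup x y \<in> G" "\<And>x y. x \<in> G \<Longrightarrow> y \<in> G \<Longrightarrow> inf x y \<in> G"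
    "\<And>x. x \<in> G \<Longrightarrow> \<bar>x\<bar> \<in> G"
  using assms unfolding vector_sublattice_def
  by (auto simp: subspace_0 subspace_add subspace_diff subspace_scale subspace_neg abs_lattice)

text \<open>A decreasing net matters below only through its range, so such nets are handled as
  downward directed sets, which frees the arguments from index types.\<close>

definition decreasing_to_zero :: "'a::vector_lattice set \<Rightarrow> 'a set \<Rightarrow> bool" where
  "decreasing_to_zero L D \<longleftrightarrow> D \<noteq> {} \<and> D \<subseteq> L \<and> inf_in L D 0 \<and>
     (\<forall>a\<in>D. \<forall>b\<in>D. \<exists>c\<in>D. c \<le> a \<and> c \<le> b)"

lemma decreasing_to_zero_directed:
  "decreasing_to_zero L D \<Longrightarrow> a \<in> D \<Longrightarrow> b \<in> D \<Longrightarrow> \<exists>c\<in>D. c \<le> a \<and> c \<le> b"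
  unfolding decreasing_to_zero_def by blast

text \<open>Turns a downward directed set into a net indexed by itself: being further along means
  being smaller.\<close>

definition ge_rel :: "'a::order set \<Rightarrow> 'a rel" where
  "ge_rel D = {(a, b). a \<in> D \<and> b \<in> D \<and> b \<le> a}"

lemma decreases_to_ge_rel:
  assumes "decreasing_to_zero L D"
  shows "decreases_to L (ge_rel D) (\<lambda>d. d) 0" "directed (ge_rel D)" "Field (ge_rel D) = D"
proof -
  have "trans (ge_rel D)" "D \<noteq> {}" "ge_rel D \<subseteq> D \<times> D"
    using assms by (auto simp: ge_rel_def trans_def decreasing_to_zero_def)
  moreover have "\<exists>c. (a, c) \<in> ge_rel D \<and> (b, c) \<in> ge_rel D" if "a \<in> D" "b \<in> D" for a b
    using assms that unfolding decreasing_to_zero_def ge_rel_def by fast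
  moreover have "(a, a) \<in> ge_rel D" if "a \<in> D" for a using that by (simp add: ge_rel_def)
  ultimately show *: "directed (ge_rel D)" "Field (ge_rel D) = D"
    using directedI[of D "ge_rel D"] by blast+
  show "decreases_to L (ge_rel D) (\<lambda>d. d) 0"
    using assms * by (auto simp: decreases_to_def net_in_def decreasing_to_zero_def) (auto simp: ge_rel_def)
qed

lemma decreasing_to_zero_range:
  assumes "decreases_to L r x 0"
  shows "decreasing_to_zero L (x ` Field r)"
proof -
  have r: "directed r" and m: "\<And>a b. (a, b) \<in> r \<Longrightarrow> x b \<le> x a"
    using assms by (auto simp: decreases_to_def net_in_def)
  have "\<exists>c\<in>Field r. x c \<le> x a \<and> x c \<le> x b" if "a \<in> Field r" "b \<in> Field r" for a b
    using directed_ub[OF r that] m by (metis FieldI2)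
  then show ?thesis
    using assms r by (auto simp: decreasing_to_zero_def decreases_to_def net_in_def directed_def)
qed

lemma regular_decreasing_to_zero:
  assumes "regular_sublattice G" "decreasing_to_zero G D"
  shows "decreasing_to_zero UNIV D"
  using decreasing_to_zero_range[OF regular_sublattice_any_index[OF assms(1) decreases_to_ge_rel(1)[OF assms(2)]]]
  by (simp add: decreases_to_ge_rel[OF assms(2)])

text \<open>Testing nonnegative lower bounds suffices: if \<open>g\<close> is a lower bound of a set
  of nonnegative elements, so is \<open>sup g 0\<close>.\<close>

lemma inf_in_zeroI:
  assumes "vector_sublattice L" "\<And>d. d \<in> D \<Longrightarrow> 0 \<le> d"
    and "\<And>g. g \<in> L \<Longrightarrow> 0 \<le> g \<Longrightarrow> (\<And>d. d \<in> D \<Longrightarrow> g \<le> d) \<Longrightarrow> g = 0"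
  shows "inf_in L D 0"
  unfolding inf_in_def
proof (intro conjI ballI impI)
  fix g assume g: "g \<in> L" "\<forall>d\<in>D. g \<le> d"
  have "sup g 0 = 0" by (rule assms(3)) (use g assms(2) vector_sublatticeD(1,6)[OF assms(1)] in auto)
  then show "g \<le> 0" by (metis sup_ge1)
qed (use assms(2) vector_sublatticeD(1)[OF assms(1)] in auto)

text \<open>Moves a set that decreases in the whole space into \<open>F\<close>, where the
  functionals live. A lower bound of the truncations is also a lower bound of
  \<open>D\<close>.\<close>

lemma decreasing_to_zero_inf:
  assumes "decreasing_to_zero UNIV D" "vector_sublattice F" "0 \<le> u" "\<And>d. d \<in> D \<Longrightarrow> inf d u \<in> F"
  shows "decreasing_to_zero F ((\<lambda>d. inf d u) ` D)"
proof -
  have D: "D \<noteq> {}" "\<And>d. d \<in> D \<Longrightarrow> 0 \<le> d" "\<And>g. (\<And>d. d \<in> D \<Longrightarrow> g \<le> d) \<Longrightarrow> g \<le> 0"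
    "\<And>a b. a \<in> D \<Longrightarrow> b \<in> D \<Longrightarrow> \<exists>c\<in>D. c \<le> a \<and> c \<le> b"
    using assms(1) by (auto simp: decreasing_to_zero_def inf_in_def)
  have "\<exists>c\<in>D. inf c u \<le> inf a u \<and> inf c u \<le> inf b u" if "a \<in> D" "b \<in> D" for a b
    using D(4)[OF that] by (meson inf_mono order_refl)
  moreover have "inf_in F ((\<lambda>d. inf d u) ` D) 0"
  proof (rule inf_in_zeroI[OF assms(2)])
    fix g assume g: "0 \<le> g" "\<And>d. d \<in> (\<lambda>d. inf d u) ` D \<Longrightarrow> g \<le> d"
    have "g \<le> d" if "d \<in> D" for d using g(2)[of "inf d u"] that by simp
    then have "g \<le> 0" by (rule D(3))
    then show "g = 0" using g(1) by simp
  qed (use D(2) assms(3) in auto)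
  ultimately show ?thesis using D assms by (auto simp: decreasing_to_zero_def)
qed

text \<open>Induction with \<open>step\<close> keeps every multiple of \<open>w\<close> below
  \<open>c\<close>, so the Archimedean property forces \<open>w\<close> to vanish.\<close>

lemma archimedean_multiples:
  fixes w c :: "'a::archimedean_vector_lattice"
  assumes "0 \<le> w" "0 \<le> c" and step: "\<And>n. real n *\<^sub>R w \<le> c \<Longrightarrow> real n *\<^sub>R w + w \<le> c"
  shows "w = 0"
proof (rule archimedean[OF assms(1)])
  show "real n *\<^sub>R w \<le> c" for n
    by (induction n) (use assms in \<open>auto simp: algebra_simps\<close>)
qed

text \<open>In the Dedekind completion this says that \<open>b - s\<close> decreases to \<open>0\<close> as \<open>s\<close> increases to
  \<open>sup S\<close> and \<open>b\<close> decreases to it.\<close>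

lemma upper_bounds_minus_decreasing:
  fixes G :: "'a::archimedean_vector_lattice set"
  assumes G: "vector_sublattice G" and S: "S \<subseteq> G" "S \<noteq> {}"
    and dir: "\<And>a b. a \<in> S \<Longrightarrow> b \<in> S \<Longrightarrow> \<exists>c\<in>S. a \<le> c \<and> b \<le> c"
    and y: "y \<in> G" "\<And>s. s \<in> S \<Longrightarrow> s \<le> y"
  shows "decreasing_to_zero G {b - s | b s. b \<in> G \<and> (\<forall>t\<in>S. t \<le> b) \<and> s \<in> S}" (is "decreasing_to_zero G ?D")
proof -
  note c = vector_sublatticeD[OF G]
  obtain s0 where s0: "s0 \<in> S" using S by blast
  have "inf_in G ?D 0"
  proof (rule inf_in_zeroI[OF G])
    fix g assume g: "g \<in> G" "0 \<le> g" "\<And>d. d \<in> ?D \<Longrightarrow> g \<le> d"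
    show "g = 0"
    proof (rule archimedean_multiples[OF g(2)])
      \<comment> \<open>From \<open>g \<le> b - s\<close> for all \<open>s\<close> it follows that
        \<open>b - g\<close> is again an upper bound of \<open>S\<close>. Starting at
        \<open>y\<close>, this can be repeated forever.\<close>
      have *: "y - real n *\<^sub>R g \<in> G \<and> (\<forall>s\<in>S. s \<le> y - real n *\<^sub>R g)" for n
      proof (induction n)
        case (Suc n)
        then have "g \<le> y - real n *\<^sub>R g - s" if "s \<in> S" for s using that by (intro g(3)) blast
        then show ?case using Suc c(3)[of "y - real n *\<^sub>R g" g] g(1) by (auto simp: algebra_simps)
      qed (use y in auto)
      show "0 \<le> y - s0" using y s0 by simp
      show "real n *\<^sub>R g + g \<le> y - s0" for n using *[of "Suc n"] s0 by (auto simp: algebra_simps)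
    qed
  qed auto
  moreover
  have "\<exists>d\<in>?D. d \<le> b - s \<and> d \<le> b' - s'"
    if "b \<in> G" "\<forall>t\<in>S. t \<le> b" "s \<in> S" "b' \<in> G" "\<forall>t\<in>S. t \<le> b'" "s' \<in> S" for b s b' s'
  proof -
    obtain t where t: "t \<in> S" "s \<le> t" "s' \<le> t" using dir[OF \<open>s \<in> S\<close> \<open>s' \<in> S\<close>] by blast
    have "inf b b' \<in> G" "\<forall>t\<in>S. t \<le> inf b b'" using that c(7) by auto
    then have "inf b b' - t \<in> ?D" using t(1) by blast
    moreover have "inf b b' - t \<le> b - s" "inf b b' - t \<le> b' - s'"
      using t(2,3) by (simp_all add: diff_mono)
    ultimately show ?thesis by blast
  qed
  then have "\<forall>d\<in>?D. \<forall>d'\<in>?D. \<exists>d''\<in>?D. d'' \<le> d \<and> d'' \<le> d'" by blast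
  moreover have "?D \<subseteq> G" using c(3) S(1) by blast
  moreover have "y - s0 \<in> ?D" using y s0 by blast
  ultimately show ?thesis unfolding decreasing_to_zero_def by blast
qed

text \<open>Since \<open>e - inf e s = sup e s - s\<close> and \<open>sup e s \<le> b\<close> for
  every upper bound \<open>b\<close> of \<open>S\<close> in \<open>G\<close>, a lower bound of these
  differences is one of the set in \<open>upper_bounds_minus_decreasing\<close>. This expresses that
  the truncations \<open>inf e s\<close> increase to \<open>e\<close>, even when \<open>S\<close>
  has no supremum in \<open>G\<close>.\<close>

lemma minus_inf_decreasing:
  fixes G :: "'a::archimedean_vector_lattice set"
  assumes G: "vector_sublattice G" and S: "S \<subseteq> G" "S \<noteq> {}"
    and dir: "\<And>a b. a \<in> S \<Longrightarrow> b \<in> S \<Longrightarrow> \<exists>c\<in>S. a \<le> c \<and> b \<le> c"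
    and y: "y \<in> G" "\<And>s. s \<in> S \<Longrightarrow> s \<le> y"
    and e: "e \<in> G" "\<And>b. b \<in> G \<Longrightarrow> (\<And>s. s \<in> S \<Longrightarrow> s \<le> b) \<Longrightarrow> e \<le> b"
  shows "decreasing_to_zero G ((\<lambda>s. e - inf e s) ` S)" (is "decreasing_to_zero G ?D")
proof -
  note c = vector_sublatticeD[OF G]
  have "inf_in G ?D 0"
  proof (rule inf_in_zeroI[OF G])
    fix g assume g: "g \<in> G" "0 \<le> g" "\<And>d. d \<in> ?D \<Longrightarrow> g \<le> d"
    have "g \<le> b - s" if b: "b \<in> G" "\<forall>t\<in>S. t \<le> b" "s \<in> S" for b s
    proof -
      have "e - inf e s = sup e s - s" by (rule diff_inf_eq_sup_diff)
      also have "\<dots> \<le> b - s" using b e(2)[of b] by (auto intro: diff_right_mono)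
      finally show ?thesis using g(3)[of "e - inf e s"] b(3) by (meson imageI order_trans)
    qed
    then have "g \<le> 0"
      using upper_bounds_minus_decreasing[OF G S dir y] g(1)
      unfolding decreasing_to_zero_def inf_in_def by blast
    then show "g = 0" using g(2) by simp
  qed (auto simp del: diff_inf_eq_sup)
  moreover have "\<exists>t\<in>S. e - inf e t \<le> e - inf e a \<and> e - inf e t \<le> e - inf e b" if "a \<in> S" "b \<in> S" for a b
    using dir[OF that] by (metis diff_left_mono inf_mono order_refl)
  ultimately show ?thesis using S c e unfolding decreasing_to_zero_def by (auto simp del: diff_inf_eq_sup)
qed

text \<open>Finite suprema make \<open>S\<close> directed, and their differences from
  \<open>z\<close> decrease to 0 in \<open>G\<close>, hence in the whole space by regularity. So
  \<open>z\<close> is the supremum of \<open>S\<close> there too, and a countable subset with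
  supremum \<open>z\<close> in the whole space has that supremum in \<open>G\<close>.\<close>

lemma countable_sup_property_regular_sublattice:
  fixes G :: "'a::vector_lattice set"
  assumes csp: "countable_sup_property (UNIV :: 'a set)" and reg: "regular_sublattice G"
  shows "countable_sup_property G"
  unfolding countable_sup_property_def
proof (intro allI impI, elim conjE)
  fix S z assume S: "S \<subseteq> G" "S \<noteq> {}" and z: "sup_in G S z"
  have G: "vector_sublattice G" using reg by (simp add: regular_sublattice_def)
  note c = vector_sublatticeD[OF G]
  have zG: "z \<in> G" using z by (simp add: sup_in_def)
  let ?K = "{T. finite T \<and> T \<noteq> {} \<and> T \<subseteq> S}"
  have fin: "Sup_fin T \<in> G" if "finite T" "T \<noteq> {}" "T \<subseteq> G" for T
    using that by (induction rule: finite_ne_induct) (auto simp: c)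
  have le: "Sup_fin T \<le> z" if "T \<in> ?K" for T
    using that z by (auto simp: sup_in_def intro!: Sup_fin.boundedI)
  have single: "z - s \<in> (\<lambda>T. z - Sup_fin T) ` ?K" if "s \<in> S" for s
    using that by (intro image_eqI[of _ _ "{s}"]) auto
  have "inf_in G ((\<lambda>T. z - Sup_fin T) ` ?K) 0"
  proof (rule inf_in_zeroI[OF G])
    fix g assume g: "g \<in> G" "0 \<le> g" "\<And>d. d \<in> (\<lambda>T. z - Sup_fin T) ` ?K \<Longrightarrow> g \<le> d"
    have "s \<le> z - g" if "s \<in> S" for s using g(3)[OF single[OF that]] by (simp add: algebra_simps)
    then have "z \<le> z - g" using z c(3)[OF zG g(1)] unfolding sup_in_def by blast
    then show "g = 0" using g(2) by simp
  next
    fix d assume "d \<in> (\<lambda>T. z - Sup_fin T) ` ?K"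
    then obtain T where "T \<in> ?K" "d = z - Sup_fin T" by blast
    then show "0 \<le> d" using le[of T] by simp
  qed
  moreover have "\<exists>T\<in>?K. z - Sup_fin T \<le> z - Sup_fin A \<and> z - Sup_fin T \<le> z - Sup_fin B"
    if "A \<in> ?K" "B \<in> ?K" for A B
    using that by (intro bexI[of _ "A \<union> B"]) (auto simp: Sup_fin.union)
  moreover have "?K \<noteq> {}"
  proof -
    obtain s where "s \<in> S" using S by blast
    then have "{s} \<in> ?K" by simp
    then show ?thesis by blast
  qed
  moreover have "(\<lambda>T. z - Sup_fin T) ` ?K \<subseteq> G" using fin S(1) c(3)[OF zG] by blast
  ultimately have "decreasing_to_zero G ((\<lambda>T. z - Sup_fin T) ` ?K)"
    unfolding decreasing_to_zero_def by (simp only: image_is_empty ball_simps bex_simps) blast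
  from regular_decreasing_to_zero[OF reg this]
  have "inf_in UNIV ((\<lambda>T. z - Sup_fin T) ` ?K) 0" by (simp only: decreasing_to_zero_def)
  then have lower: "g \<le> 0" if "\<And>d. d \<in> (\<lambda>T. z - Sup_fin T) ` ?K \<Longrightarrow> g \<le> d" for g
    unfolding inf_in_def using that by simp
  have "sup_in UNIV S z"
    unfolding sup_in_def
  proof (intro conjI ballI impI)
    show "s \<le> z" if "s \<in> S" for s using z that by (simp add: sup_in_def)
    fix t assume t: "\<forall>s\<in>S. s \<le> t"
    have "z - t \<le> 0"
    proof (rule lower)
      fix d assume "d \<in> (\<lambda>T. z - Sup_fin T) ` ?K"
      then obtain T where T: "T \<in> ?K" "d = z - Sup_fin T" by blast
      then have "Sup_fin T \<le> t" using t by (auto intro!: Sup_fin.boundedI)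
      then show "z - t \<le> d" using T by (simp add: diff_left_mono)
    qed
    then show "z \<le> t" by simp
  qed simp
  then obtain C where C: "C \<subseteq> S" "countable C" "sup_in UNIV C z"
    using csp S(2) unfolding countable_sup_property_def by (meson subset_UNIV)
  have "sup_in G C z" using C(3) zG by (simp add: sup_in_def)
  then show "\<exists>C\<subseteq>S. countable C \<and> sup_in G C z" using C by blast
qed

section \<open>Closures in Hausdorff uo-Lebesgue topologies\<close>

locale uo_Lebesgue_sublattice =
  fixes G :: "'a::archimedean_vector_lattice set" and \<tau> :: "'a topology"
  assumes sublattice: "vector_sublattice G" and uo_Lebesgue: "uo_Lebesgue_topology G \<tau>"
begin

lemmas closed [simp] = vector_sublatticeD[OF sublattice]

lemma topspace [simp]: "topspace \<tau> = G"
  and continuous_add: "continuous_map (prod_topology \<tau> \<tau>) \<tau> (\<lambda>(x, y). x + y)"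
  and solid_base: "neighbourhood_base_at 0 (solid_in G) \<tau>"
  using uo_Lebesgue by (auto simp: uo_Lebesgue_topology_def locally_solid_linear_topology_def)

definition solid_nbhd :: "'a set \<Rightarrow> bool" where
  "solid_nbhd W \<longleftrightarrow> solid_in G W \<and> (\<exists>U. openin \<tau> U \<and> 0 \<in> U \<and> U \<subseteq> W)"

lemma solid_nbhdD:
  assumes "solid_nbhd W"
  shows "0 \<in> W" "W \<subseteq> G" "\<And>x y. x \<in> W \<Longrightarrow> y \<in> G \<Longrightarrow> \<bar>y\<bar> \<le> \<bar>x\<bar> \<Longrightarrow> y \<in> W"
  using assms by (auto simp: solid_nbhd_def solid_in_def)

lemma solid_nbhd_Int:
  assumes "solid_nbhd V" "solid_nbhd W"
  shows "solid_nbhd (V \<inter> W)"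
proof -
  obtain A B where "openin \<tau> A" "0 \<in> A" "A \<subseteq> V" "openin \<tau> B" "0 \<in> B" "B \<subseteq> W"
    using assms unfolding solid_nbhd_def by blast
  then have "openin \<tau> (A \<inter> B)" "0 \<in> A \<inter> B" "A \<inter> B \<subseteq> V \<inter> W" by blast+
  then show ?thesis using assms unfolding solid_nbhd_def solid_in_def by blast
qed

lemma solid_nbhd_within:
  assumes "openin \<tau> U" "0 \<in> U"
  obtains W where "solid_nbhd W" "W \<subseteq> U"
  using solid_base assms unfolding neighbourhood_base_at_def solid_nbhd_def by metis

lemma solid_nbhd_halve:
  assumes "solid_nbhd W"
  obtains V where "solid_nbhd V" "\<And>x y. x \<in> V \<Longrightarrow> y \<in> V \<Longrightarrow> x + y \<in> W"
proof -
  obtain U where U: "openin \<tau> U" "0 \<in> U" "U \<subseteq> W" using assms unfolding solid_nbhd_def by blast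
  let ?P = "{p \<in> topspace (prod_topology \<tau> \<tau>). (\<lambda>(x, y). x + y) p \<in> U}"
  have "openin (prod_topology \<tau> \<tau>) ?P"
    using openin_continuous_map_preimage[OF continuous_add U(1)] .
  moreover have "(0, 0) \<in> ?P" using U by simp
  ultimately obtain A B where AB: "openin \<tau> A" "openin \<tau> B" "0 \<in> A" "0 \<in> B" "A \<times> B \<subseteq> ?P"
    unfolding openin_prod_topology_alt by meson
  obtain V where "solid_nbhd V" "V \<subseteq> A \<inter> B"
    by (rule solid_nbhd_within[of "A \<inter> B"]) (use AB in auto)
  moreover have "x + y \<in> W" if "x \<in> A" "y \<in> B" for x y using subsetD[OF AB(5), of "(x, y)"] U(3) that by auto
  ultimately show thesis using that by blast
qed

text \<open>Subtracting \<open>l\<close> is continuous, being addition with a fixed second argument,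
  so the preimage of a neighbourhood of 0 is a neighbourhood of \<open>l\<close> and meets
  \<open>A\<close>.\<close>

lemma solid_nbhd_translate:
  assumes "l \<in> \<tau> closure_of A" "solid_nbhd W"
  obtains a where "a \<in> A" "a - l \<in> W"
proof -
  obtain U where U: "openin \<tau> U" "0 \<in> U" "U \<subseteq> W" using assms unfolding solid_nbhd_def by blast
  have l: "l \<in> G" using assms(1) by (simp add: in_closure_of)
  have "continuous_map \<tau> \<tau> ((\<lambda>(x, y). x + y) \<circ> (\<lambda>x. (x, - l)))"
    by (rule continuous_map_compose[OF _ continuous_add])
      (use l in \<open>auto simp: continuous_map_pairwise comp_def\<close>)
  then have "openin \<tau> {x \<in> topspace \<tau>. ((\<lambda>(x, y). x + y) \<circ> (\<lambda>x. (x, - l))) x \<in> U}"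
    using U(1) by (rule openin_continuous_map_preimage)
  then have "openin \<tau> {x \<in> G. x - l \<in> U}" by (simp add: comp_def)
  moreover have "l \<in> {x \<in> G. x - l \<in> U}" using l U by simp
  ultimately obtain a where "a \<in> A" "a \<in> {x \<in> G. x - l \<in> U}"
    using assms(1) unfolding in_closure_of by metis
  then show thesis using that U by blast
qed

text \<open>Indexed by itself, \<open>D\<close> is a net whose truncations are dominated by
  \<open>D\<close>. It is therefore uo-convergent to 0, and the uo-Lebesgue property makes it
  converge topologically.\<close>

lemma solid_nbhd_meets_decreasing:
  assumes D: "decreasing_to_zero G D" and W: "solid_nbhd W"
  obtains d where "d \<in> D" "d \<in> W"
proof -
  obtain U where U: "openin \<tau> U" "0 \<in> U" "U \<subseteq> W" using W unfolding solid_nbhd_def by blast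
  note r = decreases_to_ge_rel[OF D]
  have D': "D \<subseteq> G" "\<And>d. d \<in> D \<Longrightarrow> 0 \<le> d" using D by (auto simp: decreasing_to_zero_def inf_in_def)
  have "order_conv G (ge_rel D) (\<lambda>a. inf \<bar>a - 0\<bar> y) 0" if y: "y \<in> G" "0 \<le> y" for y
  proof (rule order_convI_any_index[OF _ _ r(1)])
    show "\<exists>a\<in>Field (ge_rel D). \<forall>c. (a, c) \<in> ge_rel D \<longrightarrow> \<bar>0 - inf \<bar>c - 0\<bar> y\<bar> \<le> b"
      if "b \<in> Field (ge_rel D)" for b
    proof (intro bexI[OF _ that] allI impI)
      fix c assume "(b, c) \<in> ge_rel D"
      then have c: "c \<in> D" "c \<le> b" by (auto simp: ge_rel_def)
      then have "0 \<le> inf c y" "inf c y \<le> b" using y D' by (auto intro: le_infI1)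
      then show "\<bar>0 - inf \<bar>c - 0\<bar> y\<bar> \<le> b" using D'(2)[OF c(1)] by (simp del: neg_inf_eq_sup)
    qed
    show "net_in G (ge_rel D) (\<lambda>a. inf \<bar>a - 0\<bar> y)"
      using r D' y by (auto simp: net_in_def)
  qed simp
  moreover have "net_in G (ge_rel D) (\<lambda>d. d)" using r D' by (auto simp: net_in_def)
  ultimately have "uo_conv G (ge_rel D) (\<lambda>d. d) 0" by (simp add: uo_conv_def)
  then have "limitin \<tau> (\<lambda>d. d) 0 (tails (ge_rel D))" using uo_Lebesgue_any_index uo_Lebesgue by blast
  then have "eventually (\<lambda>d. d \<in> U) (tails (ge_rel D))" using U by (auto simp: limitin_def)
  then obtain a where "a \<in> D" "\<forall>c. (a, c) \<in> ge_rel D \<longrightarrow> c \<in> U"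
    unfolding eventually_tails[OF r(2)] r(3) by blast
  then show thesis using that[of a] U by (auto simp: ge_rel_def)
qed

section \<open>Normal sequences of solid neighbourhoods and their null ideals\<close>

definition normal_seq :: "(nat \<Rightarrow> 'a set) \<Rightarrow> bool" where
  "normal_seq V \<longleftrightarrow> (\<forall>n. solid_nbhd (V n)) \<and> (\<forall>n. \<forall>x\<in>V (Suc n). \<forall>y\<in>V (Suc n). x + y \<in> V n)"

lemma normal_seq_nbhd: "normal_seq V \<Longrightarrow> solid_nbhd (V n)"
  by (simp add: normal_seq_def)

lemma normal_seqD:
  assumes "normal_seq V"
  shows "0 \<in> V n" "V n \<subseteq> G" "\<And>x y. x \<in> V n \<Longrightarrow> y \<in> G \<Longrightarrow> \<bar>y\<bar> \<le> \<bar>x\<bar> \<Longrightarrow> y \<in> V n"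
    "\<And>x y. x \<in> V (Suc n) \<Longrightarrow> y \<in> V (Suc n) \<Longrightarrow> x + y \<in> V n"
proof -
  have "solid_nbhd (V n)" using assms by (simp add: normal_seq_def)
  note solid_nbhdD[OF this]
  then show "0 \<in> V n" "V n \<subseteq> G" "\<And>x y. x \<in> V n \<Longrightarrow> y \<in> G \<Longrightarrow> \<bar>y\<bar> \<le> \<bar>x\<bar> \<Longrightarrow> y \<in> V n" .
  show "\<And>x y. x \<in> V (Suc n) \<Longrightarrow> y \<in> V (Suc n) \<Longrightarrow> x + y \<in> V n"
    using assms by (simp add: normal_seq_def)
qed

lemma normal_seq_antimono:
  assumes "normal_seq V" "m \<le> n"
  shows "V n \<subseteq> V m"
proof (rule lift_Suc_antimono_le[OF _ assms(2)])
  show "V (Suc n) \<le> V n" for n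
    using normal_seqD(4)[OF assms(1), of _ n 0] normal_seqD(1)[OF assms(1)] by force
qed

lemma normal_seq_Int:
  assumes "normal_seq V" "normal_seq W"
  shows "normal_seq (\<lambda>n. V n \<inter> W n)"
  using assms solid_nbhd_Int by (simp add: normal_seq_def)

lemma normal_seq_exists:
  assumes "solid_nbhd W"
  obtains V where "normal_seq V" "V 0 = W"
proof -
  have "\<exists>V. \<forall>n. (solid_nbhd (V n) \<and> (n = 0 \<longrightarrow> V n = W)) \<and> (\<forall>x\<in>V (Suc n). \<forall>y\<in>V (Suc n). x + y \<in> V n)"
  proof (rule dependent_nat_choice)
    fix U :: "'a set" and n :: nat assume "solid_nbhd U \<and> (n = 0 \<longrightarrow> U = W)"
    then obtain V where "solid_nbhd V" "\<And>x y. x \<in> V \<Longrightarrow> y \<in> V \<Longrightarrow> x + y \<in> U"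
      using solid_nbhd_halve by metis
    then show "\<exists>V. (solid_nbhd V \<and> (Suc n = 0 \<longrightarrow> V = W)) \<and> (\<forall>x\<in>V. \<forall>y\<in>V. x + y \<in> U)" by auto
  qed (use assms in auto)
  then show thesis using that unfolding normal_seq_def by metis
qed

text \<open>Both \<open>z (Suc p)\<close> and, by induction on the length, the sum of the later
  terms lie in \<open>V (Suc p)\<close>. Adding them costs one index, which is why the sum starts at
  \<open>Suc p\<close> but is only placed in \<open>V p\<close>.\<close>

lemma normal_seq_sum:
  assumes V: "normal_seq V" and z: "\<And>i. p < i \<Longrightarrow> z i \<in> V i"
  shows "sum z {Suc p..<q} \<in> V p"
proof -
  have "sum z {Suc p..<Suc p + k} \<in> V p" if "\<And>i. p < i \<Longrightarrow> z i \<in> V i" for k p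
    using that
  proof (induction k arbitrary: p)
    case (Suc k)
    have "sum z {Suc (Suc p)..<Suc (Suc p) + k} \<in> V (Suc p)" by (rule Suc.IH) (use Suc.prems in simp)
    then have "z (Suc p) + sum z {Suc (Suc p)..<Suc (Suc p) + k} \<in> V p"
      using Suc.prems[of "Suc p"] by (intro normal_seqD(4)[OF V]) auto
    moreover have "sum z {Suc p..<Suc p + Suc k} = z (Suc p) + sum z {Suc (Suc p)..<Suc (Suc p) + k}"
      by (subst sum.atLeast_Suc_lessThan) simp_all
    ultimately show ?case by simp
  qed (use normal_seqD(1)[OF V] in auto)
  from this[of p "q - Suc p"] show ?thesis
    using z by (cases "Suc p \<le> q") (auto simp: normal_seqD(1)[OF V])
qed

text \<open>If \<open>V n\<close> is thought of as the ball of radius \<open>1 / 2 ^ n\<close> of a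
  Riesz pseudonorm, this is the kernel of the pseudonorm.\<close>

definition null :: "(nat \<Rightarrow> 'a set) \<Rightarrow> 'a set" where
  "null V = (\<Inter>n. V n)"

lemma nullD:
  assumes "normal_seq V"
  shows "0 \<in> null V" "null V \<subseteq> G" "\<And>x y. x \<in> null V \<Longrightarrow> y \<in> G \<Longrightarrow> \<bar>y\<bar> \<le> \<bar>x\<bar> \<Longrightarrow> y \<in> null V"
    "\<And>x y. x \<in> null V \<Longrightarrow> y \<in> null V \<Longrightarrow> x + y \<in> null V"
proof -
  show "0 \<in> null V" "null V \<subseteq> G" using normal_seqD(1)[OF assms] normal_seqD(2)[OF assms, of 0] by (auto simp: null_def)
  show "y \<in> null V" if "x \<in> null V" "y \<in> G" "\<bar>y\<bar> \<le> \<bar>x\<bar>" for x y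
    using normal_seqD(3)[OF assms _ that(2,3)] that(1) by (simp add: null_def)
  show "x + y \<in> null V" if "x \<in> null V" "y \<in> null V" for x y
    using normal_seqD(4)[OF assms] that by (simp add: null_def)
qed

text \<open>If every nonzero positive element below \<open>c\<close> met \<open>null V\<close>, then
  \<open>c\<close> would lie below all upper bounds of the part of \<open>null V\<close> between 0
  and \<open>c\<close>. The differences \<open>c - s\<close> would then decrease to 0 and enter
  every neighbourhood, which would put \<open>c\<close> itself into \<open>null V\<close>.\<close>

lemma carrier_meets:
  assumes V: "normal_seq V" and c: "c \<in> G" "0 \<le> c" "c \<notin> null V"
  obtains u where "u \<in> G" "0 < u" "u \<le> c" "\<And>w. w \<in> null V \<Longrightarrow> inf \<bar>w\<bar> u = 0"
proof (rule ccontr)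
  assume "\<not> thesis"
  with that have ex: "\<exists>w\<in>null V. inf \<bar>w\<bar> u \<noteq> 0" if "u \<in> G" "0 < u" "u \<le> c" for u using that by blast
  note N = nullD[OF V]
  define S where "S = {w \<in> null V. 0 \<le> w \<and> w \<le> c}"
  have S0: "0 \<in> S" using N c by (simp add: S_def)
  have SG: "S \<subseteq> G" using N by (auto simp: S_def)
  have dir: "\<exists>d\<in>S. a \<le> d \<and> b \<le> d" if "a \<in> S" "b \<in> S" for a b
  proof (rule bexI[of _ "sup a b"])
    have ab: "0 \<le> a" "0 \<le> b" using that by (auto simp: S_def)
    have "\<bar>sup a b\<bar> \<le> \<bar>a + b\<bar>" using ab by (simp add: le_supI1)
    then have "sup a b \<in> null V" using that SG by (intro N(3)[OF N(4), of a b "sup a b"]) (auto simp: S_def intro!: closed)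
    then show "sup a b \<in> S" using that by (auto simp: S_def intro: le_supI1)
  qed auto
  have ub: "c \<le> b" if b: "b \<in> G" "\<And>s. s \<in> S \<Longrightarrow> s \<le> b" for b
  proof (rule ccontr)
    assume "\<not> c \<le> b"
    \<comment> \<open>The excess of \<open>c\<close> over \<open>b\<close> meets
      \<open>null V\<close> in some \<open>w\<close> different from 0. A multiple of
      \<open>w\<close> below \<open>c\<close> lies in \<open>S\<close>, hence below
      \<open>b\<close>, and since \<open>w \<le> d\<close> there is room below \<open>c\<close> for
      one more copy of \<open>w\<close>.\<close>
    define d where "d = c - inf c b"
    have b0: "0 \<le> b" using b S0 by blast
    have d0: "0 < d" using \<open>\<not> c \<le> b\<close> unfolding d_def by (metis diff_gt_0_iff_gt inf.cobounded1 inf.cobounded2 order_neq_le_trans)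
    have d: "d \<in> G" "d \<le> c" using b b0 c unfolding d_def by (auto simp del: diff_inf_eq_sup)
    obtain v where v: "v \<in> null V" "inf \<bar>v\<bar> d \<noteq> 0" using ex[OF d(1) d0 d(2)] by blast
    define w where "w = inf \<bar>v\<bar> d"
    have w: "0 \<le> w" "w \<le> d" "w \<noteq> 0" using v d0 by (auto simp: w_def)
    have wN: "w \<in> null V"
    proof (rule N(3)[OF v(1)])
      show "w \<in> G" using v(1) N(2) d(1) by (auto simp: w_def)
      show "\<bar>w\<bar> \<le> \<bar>v\<bar>" using w by (simp add: w_def)
    qed
    have mult: "real n *\<^sub>R w \<in> null V" for n
      by (induction n) (use N wN in \<open>auto simp: algebra_simps\<close>)
    have "w = 0"
    proof (rule archimedean_multiples[OF w(1) c(2)])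
      fix n assume "real n *\<^sub>R w \<le> c"
      then have "real n *\<^sub>R w \<in> S" using mult w by (simp add: S_def scaleR_nonneg_nonneg)
      then have "real n *\<^sub>R w \<le> inf c b" using b \<open>real n *\<^sub>R w \<le> c\<close> by simp
      then have "real n *\<^sub>R w + w \<le> inf c b + d" using w by (intro add_mono)
      also have "inf c b + d = c" unfolding d_def by (subst add.commute) (rule diff_add_cancel)
      finally show "real n *\<^sub>R w + w \<le> c" .
    qed
    then show False using w by simp
  qed
  have "decreasing_to_zero G ((\<lambda>s. c - inf c s) ` S)"
    by (rule minus_inf_decreasing[OF sublattice SG _ dir c(1) _ c(1) ub]) (use S0 in \<open>auto simp: S_def\<close>)
  moreover have "(\<lambda>s. c - inf c s) ` S = (\<lambda>s. c - s) ` S"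
    by (rule image_cong) (auto simp: S_def inf_absorb2)
  ultimately have D: "decreasing_to_zero G ((\<lambda>s. c - s) ` S)" by simp
  \<comment> \<open>Halving: \<open>c\<close> is the sum of \<open>c - s\<close> and
    \<open>s\<close>, both in \<open>V (Suc n)\<close>, the second because it lies in
    \<open>null V\<close>.\<close>
  have "c \<in> V n" for n
  proof -
    obtain s where s: "s \<in> S" "c - s \<in> V (Suc n)"
      using solid_nbhd_meets_decreasing[OF D normal_seq_nbhd[OF V, of "Suc n"]] by blast
    then have "s \<in> V (Suc n)" by (auto simp: S_def null_def)
    then show ?thesis using normal_seqD(4)[OF V s(2), of s] by simp
  qed
  then show False using c by (simp add: null_def)
qed

end

section \<open>Carriers and the construction of uo-convergent sequences\<close>

locale Hausdorff_uo_Lebesgue_sublattice = uo_Lebesgue_sublattice +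
  assumes Hausdorff: "Hausdorff_space \<tau>" and countable_sup: "countable_sup_property G"
begin

lemma normal_seq_separating:
  assumes "c \<in> G" "c \<noteq> 0"
  obtains V where "normal_seq V" "c \<notin> null V"
proof -
  obtain U where "openin \<tau> U" "0 \<in> U" "c \<notin> U"
    using Hausdorff assms closed(1) unfolding Hausdorff_space_def topspace disjnt_iff by metis
  then obtain W where "solid_nbhd W" "c \<notin> W" using solid_nbhd_within by blast
  then obtain V where "normal_seq V" "c \<notin> V 0" using normal_seq_exists by metis
  then show thesis using that unfolding null_def by blast
qed

text \<open>By \<open>carrier_meets\<close>, \<open>z\<close> is the supremum of the elements below
  it that are disjoint from some null ideal. Countably many of them suffice, and a diagonal
  intersection combines their normal sequences into one.\<close>

lemma normal_seq_carrier:
  assumes z: "z \<in> G" "0 \<le> z"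
  obtains W where "normal_seq W" "\<And>w. w \<in> null W \<Longrightarrow> inf \<bar>w\<bar> z = 0"
proof -
  define S where "S = {u \<in> G. 0 \<le> u \<and> u \<le> z \<and> (\<exists>V. normal_seq V \<and> (\<forall>w\<in>null V. inf \<bar>w\<bar> u = 0))}"
  have "solid_nbhd G" unfolding solid_nbhd_def solid_in_def
    using closed(1) openin_topspace[of \<tau>] by auto
  then obtain V0 where "normal_seq V0" using normal_seq_exists by metis
  then have S0: "0 \<in> S" using z by (auto simp: S_def inf_absorb2)
  have "sup_in G S z" unfolding sup_in_def
  proof (intro conjI ballI impI)
    fix b assume b: "b \<in> G" "\<forall>s\<in>S. s \<le> b"
    show "z \<le> b"
    proof (rule ccontr)
      assume "\<not> z \<le> b"
      \<comment> \<open>Some positive \<open>u\<close> below the excess of \<open>z\<close> over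
        \<open>b\<close> is disjoint from a null ideal, and so are its multiples. Those below
        \<open>z\<close> thus lie in \<open>S\<close>, hence below \<open>b\<close>, which again
        leaves room for one more copy of \<open>u\<close>.\<close>
      define c where "c = z - inf z b"
      have b0: "0 \<le> b" using b S0 by blast
      have c0: "0 < c" using \<open>\<not> z \<le> b\<close> unfolding c_def by (metis diff_gt_0_iff_gt inf.cobounded1 inf.cobounded2 order_neq_le_trans)
      have c: "c \<in> G" "c \<le> z" using b b0 z unfolding c_def by (auto simp del: diff_inf_eq_sup)
      obtain V where V: "normal_seq V" "c \<notin> null V" using normal_seq_separating[OF c(1)] c0 by blast
      obtain u where u: "u \<in> G" "0 < u" "u \<le> c" and dis: "\<And>w. w \<in> null V \<Longrightarrow> inf \<bar>w\<bar> u = 0"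
        using carrier_meets[OF V(1) c(1) _ V(2)] c0 by (metis less_imp_le)
      have mult: "inf \<bar>w\<bar> (real n *\<^sub>R u) = 0" if "w \<in> null V" for n w
      proof (induction n)
        case (Suc n)
        have "inf \<bar>w\<bar> (real n *\<^sub>R u + u) = 0"
          by (rule disjoint_add) (use Suc dis[OF that] u in \<open>auto simp: scaleR_nonneg_nonneg\<close>)
        then show ?case by (simp add: algebra_simps)
      qed (simp add: inf_absorb2)
      have "u = 0"
      proof (rule archimedean_multiples[OF less_imp_le[OF u(2)] z(2)])
        fix n assume n: "real n *\<^sub>R u \<le> z"
        have "real n *\<^sub>R u \<in> S"
          unfolding S_def using n mult u V(1) closed(4)[OF u(1)] by (auto simp: scaleR_nonneg_nonneg)
        then have "real n *\<^sub>R u \<le> inf z b" using b n by simp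
        then have "real n *\<^sub>R u + u \<le> inf z b + c" using u by (intro add_mono)
        also have "inf z b + c = z" unfolding c_def by (subst add.commute) (rule diff_add_cancel)
        finally show "real n *\<^sub>R u + u \<le> z" .
      qed
      then show False using u by simp
    qed
  qed (use z in \<open>auto simp: S_def\<close>)
  moreover have "S \<subseteq> G" "S \<noteq> {}" using S0 by (auto simp: S_def)
  ultimately obtain C0 where C0: "C0 \<subseteq> S" "countable C0" "sup_in G C0 z"
    using countable_sup unfolding countable_sup_property_def by meson
  \<comment> \<open>Adding 0, an element of \<open>S\<close>, keeps the upper bounds under control
    and makes the set nonempty, so that \<open>from_nat_into\<close> enumerates it.\<close>
  define C where "C = insert 0 C0"
  have C: "C \<subseteq> S" "countable C" "C \<noteq> {}" using C0 S0 by (auto simp: C_def)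
  have supC: "z \<le> b" if "b \<in> G" "\<And>s. s \<in> C \<Longrightarrow> s \<le> b" for b
    using C0(3) that unfolding sup_in_def C_def by blast
  have "\<exists>V. normal_seq V \<and> (\<forall>w\<in>null V. inf \<bar>w\<bar> u = 0)" if "u \<in> S" for u
    using that by (simp add: S_def)
  then obtain V where V: "\<And>u. u \<in> S \<Longrightarrow> normal_seq (V u)"
    "\<And>u w. u \<in> S \<Longrightarrow> w \<in> null (V u) \<Longrightarrow> inf \<bar>w\<bar> u = 0" by metis
  define c where "c = from_nat_into C"
  have c: "c j \<in> S" for j using C from_nat_into[of C j] by (auto simp: c_def)
  \<comment> \<open>Each \<open>W n\<close> is a finite intersection, hence still a neighbourhood,
    and passing from \<open>n\<close> to \<open>Suc n\<close> only adds a constraint.\<close>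
  define W where "W n = (\<Inter>j\<le>n. V (c j) n)" for n
  show thesis
  proof
    have "solid_nbhd (\<Inter>j\<le>m. V (c j) n)" for m n
    proof (induction m)
      case (Suc m)
      then show ?case using solid_nbhd_Int[of "V (c (Suc m)) n" "\<Inter>j\<le>m. V (c j) n"] V(1)[OF c]
        by (simp add: atMost_Suc normal_seq_def)
    qed (use V(1)[OF c] in \<open>simp add: normal_seq_def\<close>)
    then have "solid_nbhd (W n)" for n by (simp only: W_def)
    moreover have "x + y \<in> W n" if "x \<in> W (Suc n)" "y \<in> W (Suc n)" for x y n
      using that by (auto simp: W_def intro!: normal_seqD(4)[OF V(1)[OF c]])
    ultimately show "normal_seq W" by (simp add: normal_seq_def)
    fix w assume w: "w \<in> null W"
    have "w \<in> V (c j) n" for j n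
    proof -
      \<comment> \<open>The sequence \<open>V (c j)\<close> takes part in \<open>W\<close> only from
        index \<open>j\<close> on.\<close>
      have "w \<in> W (max j n)" using w by (simp add: null_def)
      then have "w \<in> V (c j) (max j n)" by (simp add: W_def)
      then show ?thesis using normal_seq_antimono[OF V(1)[OF c], of n "max j n"] by auto
    qed
    then have "w \<in> null (V (c j))" for j by (simp add: null_def)
    then have "inf \<bar>w\<bar> (c j) = 0" for j using V(2)[OF c] by blast
    moreover have "range c = C" unfolding c_def by (rule range_from_nat_into[OF C(3,2)])
    ultimately have dis: "inf \<bar>w\<bar> u = 0" if "u \<in> C" for u using that by blast
    define p where "p = inf \<bar>w\<bar> z"
    have p: "0 \<le> p" "p \<le> z" using z by (auto simp: p_def)
    have "w \<in> V (c 0) 0" using \<open>w \<in> null (V (c _))\<close> by (simp add: null_def)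
    then have "w \<in> G" using normal_seqD(2)[OF V(1)[OF c]] by blast
    then have "p \<in> G" using z by (auto simp: p_def)
    have "u \<le> z - p" if "u \<in> C" for u
    proof -
      have u: "0 \<le> u" "u \<le> z" using that C by (auto simp: S_def)
      have "inf u p \<le> inf \<bar>w\<bar> u" by (simp add: p_def le_infI1 le_infI2)
      then have "inf u p = 0" using dis[OF that] u p by (simp add: order_antisym)
      \<comment> \<open>For disjoint elements the sum is the supremum, so it stays below
        \<open>z\<close>. Hence \<open>z - p\<close> bounds \<open>C\<close> from above, which is
        possible only for \<open>p = 0\<close>.\<close>
      then have "u + p = sup u p" using add_eq_inf_sup[of u p] by simp
      then have "u + p \<le> z" using u p by simp
      then show ?thesis by (simp add: algebra_simps)
    qed
    then have "z \<le> z - p" using \<open>p \<in> G\<close> z by (intro supC) auto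
    then have "p \<le> 0" by simp
    then show "inf \<bar>w\<bar> z = 0" using p(1) unfolding p_def by (rule order_antisym)
  qed
qed

lemma closure_of_subset_suo_adh: "\<tau> closure_of A \<subseteq> suo_adh G A" if "A \<subseteq> G"
proof
  fix l assume l: "l \<in> \<tau> closure_of A"
  have lG: "l \<in> G" using l by (simp add: in_closure_of)
  have "\<exists>W. normal_seq W \<and> (\<forall>w\<in>null W. inf \<bar>w\<bar> \<bar>x - l\<bar> = 0)" if "x \<in> G" for x
    using normal_seq_carrier[of "\<bar>x - l\<bar>"] that lG closed(3,8) by (metis abs_ge_zero)
  then obtain W where W: "\<And>x. x \<in> G \<Longrightarrow> normal_seq (W x)"
    "\<And>x w. x \<in> G \<Longrightarrow> w \<in> null (W x) \<Longrightarrow> inf \<bar>w\<bar> \<bar>x - l\<bar> = 0" by metis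
  \<comment> \<open>The state of the recursion is the current point together with a normal sequence
    that lies below those of all points chosen so far.\<close>
  let ?P = "\<lambda>(n::nat) (x, V). x \<in> A \<and> normal_seq V \<and> (\<forall>m. V m \<subseteq> W x m)"
  let ?Q = "\<lambda>(n::nat) (x, V) (x', V'). x' - l \<in> V (Suc n) \<and> (\<forall>m. V' m \<subseteq> V m)"
  have "\<exists>f. \<forall>n. ?P n (f n) \<and> ?Q n (f n) (f (Suc n))"
  proof (rule dependent_nat_choice)
    obtain a where "a \<in> A" using l openin_topspace[of \<tau>] by (force simp: in_closure_of)
    then have "?P 0 (a, W a)" using W(1) that by auto
    then show "\<exists>p. ?P 0 p" by blast
    fix p :: "'a \<times> (nat \<Rightarrow> 'a set)" and n assume p: "?P n p"
    obtain x V where xV: "p = (x, V)" by force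
    obtain a where a: "a \<in> A" "a - l \<in> V (Suc n)"
      using p xV solid_nbhd_translate[OF l, of "V (Suc n)"] by (auto simp: normal_seq_def)
    then have "?P (Suc n) (a, \<lambda>m. V m \<inter> W a m) \<and> ?Q n p (a, \<lambda>m. V m \<inter> W a m)"
      using p xV normal_seq_Int[of V "W a"] W(1) that by auto
    then show "\<exists>q. ?P (Suc n) q \<and> ?Q n p q" by blast
  qed
  then obtain f where f: "\<forall>n. ?P n (f n) \<and> ?Q n (f n) (f (Suc n))" ..
  define X V where "X n = fst (f n)" and "V n = snd (f n)" for n
  have XA: "X n \<in> A" and nV: "normal_seq (V n)" and VW: "V n m \<subseteq> W (X n) m"
    and step: "X (Suc n) - l \<in> V n (Suc n)" and anti: "V (Suc n) m \<subseteq> V n m" for n m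
    using spec[OF f, of n] unfolding X_def V_def by (auto split: prod.splits)
  have XG: "X n \<in> G" for n using XA that by blast
  define z where "z n = \<bar>X n - l\<bar>" for n
  have z: "z n \<in> G" "0 \<le> z n" for n using XG lG by (auto simp: z_def)
  \<comment> \<open>Since \<open>V k\<close> shrinks with \<open>k\<close>, the single normal
    sequence \<open>V k\<close> controls every term chosen after stage \<open>k\<close>.\<close>
  have zV: "z n \<in> V k n" if "k < n" for k n
  proof -
    obtain i where i: "n = Suc i" "k \<le> i" using \<open>k < n\<close> by (cases n) auto
    have "V i n \<subseteq> V k n" using lift_Suc_antimono_le[of "\<lambda>j. V j n", OF anti i(2)] .
    then have "X n - l \<in> V k n" using step[of i] i by blast
    then show ?thesis using normal_seqD(3)[OF nV _ z(1)] by (simp add: z_def)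
  qed
  have "order_conv G nat_le (\<lambda>n. inf \<bar>X n - l\<bar> y) 0" if y: "y \<in> G" "0 \<le> y" for y
  proof -
    \<comment> \<open>The eventual upper bounds of the truncated sequence. Once they are known to
      decrease to 0, they dominate the sequence by construction.\<close>
    define D where "D = {d \<in> G. \<exists>m. \<forall>n\<ge>m. inf (z n) y \<le> d}"
    have D0: "0 \<le> d" if "d \<in> D" for d
    proof -
      obtain m where "inf (z m) y \<le> d" using \<open>d \<in> D\<close> unfolding D_def by blast
      then show ?thesis using z y by (meson le_inf_iff order_trans)
    qed
    have "y \<in> D" using y by (simp add: D_def)
    have dir: "\<exists>c\<in>D. c \<le> a \<and> c \<le> b" if ab: "a \<in> D" "b \<in> D" for a b
    proof (rule bexI[of _ "inf a b"])
      obtain m m' where "\<forall>n\<ge>m. inf (z n) y \<le> a" "\<forall>n\<ge>m'. inf (z n) y \<le> b"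
        using ab by (auto simp: D_def)
      then have "\<And>n. max m m' \<le> n \<Longrightarrow> inf (z n) y \<le> inf a b"
        by (meson inf.boundedI max.boundedE)
      then show "inf a b \<in> D" using ab closed(7) unfolding D_def by blast
    qed auto
    have "inf_in G D 0"
    proof (rule inf_in_zeroI[OF sublattice D0])
      fix e assume e: "e \<in> G" "0 \<le> e" "\<And>d. d \<in> D \<Longrightarrow> e \<le> d"
      \<comment> \<open>Partial sums of the tail from \<open>m\<close>, truncated at
        \<open>y\<close> so that they have an upper bound in \<open>G\<close>.\<close>
      define S where "S m = range (\<lambda>q. inf y (sum z {m..<q}))" for m
      have sumG: "sum z {m..<q} \<in> G" for m q
        using z sublattice by (auto simp: vector_sublattice_def intro: subspace_sum)
      have dec: "decreasing_to_zero G ((\<lambda>s. e - inf e s) ` S m)" for m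
      proof (rule minus_inf_decreasing[OF sublattice _ _ _ y(1) _ e(1)])
        show "\<exists>c\<in>S m. a \<le> c \<and> b \<le> c" if ab: "a \<in> S m" "b \<in> S m" for a b
        proof -
          obtain q q' where "a = inf y (sum z {m..<q})" "b = inf y (sum z {m..<q'})"
            using ab by (auto simp: S_def)
          moreover have "sum z {m..<q} \<le> sum z {m..<max q q'}" "sum z {m..<q'} \<le> sum z {m..<max q q'}"
            using z by (auto intro!: sum_mono2)
          ultimately show ?thesis unfolding S_def by (auto intro: le_infI2)
        qed
        \<comment> \<open>An upper bound of the partial sums bounds each single term with index at
          least \<open>m\<close>, hence belongs to \<open>D\<close>.\<close>
        show "e \<le> b" if b: "b \<in> G" "\<And>s. s \<in> S m \<Longrightarrow> s \<le> b" for b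
        proof (rule e(3))
          have "inf (z n) y \<le> b" if "m \<le> n" for n
          proof -
            have *: "sum z {n} \<le> sum z {m..<Suc n}" by (rule sum_mono2) (use that z in auto)
            have "inf (z n) y = inf y (sum z {n})" by (simp add: inf_commute)
            also have "\<dots> \<le> inf y (sum z {m..<Suc n})" by (rule inf_mono[OF order_refl *])
            also have "\<dots> \<le> b" by (rule b(2)) (unfold S_def, rule rangeI)
            finally show ?thesis .
          qed
          then show "b \<in> D" using b(1) by (auto simp: D_def)
        qed
      qed (use sumG y in \<open>auto simp: S_def\<close>)
      have "inf \<bar>e\<bar> (z k) = 0" for k
      proof -
        have "e \<in> V k n" for n
        proof -
          \<comment> \<open>With \<open>p \<ge> k\<close> every index above \<open>p\<close> is
            covered by \<open>zV\<close>; with \<open>p \<ge> Suc n\<close> the tail sum lies in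
            \<open>V k (Suc n)\<close>, one level finer than the target, so that adding
            \<open>e - inf e s\<close> ends in \<open>V k n\<close>.\<close>
          define p where "p = max k (Suc n)"
          obtain s where s: "s \<in> S (Suc p)" "e - inf e s \<in> V k (Suc n)"
            using solid_nbhd_meets_decreasing[OF dec[of "Suc p"] normal_seq_nbhd[OF nV, of k "Suc n"]] by blast
          obtain q where q: "s = inf y (sum z {Suc p..<q})" using s(1) by (auto simp: S_def)
          have "sum z {Suc p..<q} \<in> V k p" by (rule normal_seq_sum[OF nV zV]) (simp add: p_def)
          then have sum: "sum z {Suc p..<q} \<in> V k (Suc n)"
            using normal_seq_antimono[OF nV[of k], of "Suc n" p] by (auto simp: p_def)
          have s0: "0 \<le> sum z {Suc p..<q}" using z by (simp add: sum_nonneg)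
          have "inf e s \<in> V k (Suc n)"
          proof (rule normal_seqD(3)[OF nV sum])
            show "inf e s \<in> G" using sumG y e by (auto simp: q)
            show "\<bar>inf e s\<bar> \<le> \<bar>sum z {Suc p..<q}\<bar>" using s0 e y by (simp add: q le_infI2)
          qed
          then show ?thesis using normal_seqD(4)[OF nV s(2)] by (metis diff_add_cancel)
        qed
        then have "e \<in> null (W (X k))" using VW unfolding null_def by blast
        then show ?thesis using W(2)[OF XG] by (simp add: z_def)
      qed
      then have dis: "inf e (z k) = 0" for k using e by simp
      \<comment> \<open>Disjointness passes to finite sums, so the truncations in \<open>S 0\<close>
        remove nothing from \<open>e\<close>: the set decreasing to 0 consists of \<open>e\<close>
        alone.\<close>
      have "inf e (sum z {0..<q}) = 0" for q
      proof (induction q)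
        case (Suc q)
        have "0 \<le> sum z {0..<q}" using z by (simp add: sum_nonneg)
        from disjoint_add[OF this z(2) e(2) Suc dis] show ?case by simp
      qed (use e in \<open>simp add: inf_absorb2\<close>)
      then have "inf e s = 0" if "s \<in> S 0" for s
        using that e y z(2) unfolding S_def by (auto simp: inf.left_commute[of e y] inf_absorb2)
      then have "\<forall>d\<in>(\<lambda>s. e - inf e s) ` S 0. e \<le> d" by (simp del: diff_inf_eq_sup)
      moreover have "inf_in G ((\<lambda>s. e - inf e s) ` S 0) 0"
        using dec[of 0] by (simp only: decreasing_to_zero_def)
      ultimately have "e \<le> 0" using e(1) unfolding inf_in_def by blast
      then show "e = 0" using e(2) by simp
    qed
    then have D: "decreasing_to_zero G D"
      using \<open>y \<in> D\<close> dir unfolding decreasing_to_zero_def by (auto simp: D_def)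
    note r = decreases_to_ge_rel[OF D]
    show ?thesis
    proof (rule order_convI_any_index[OF _ closed(1) r(1)])
      show "net_in G nat_le (\<lambda>n. inf \<bar>X n - l\<bar> y)" using z y unfolding z_def by (auto simp: net_in_def)
      fix b assume "b \<in> Field (ge_rel D)"
      then obtain m where "\<forall>n\<ge>m. inf (z n) y \<le> b" using r(3) by (auto simp: D_def)
      then show "\<exists>a\<in>Field nat_le. \<forall>c. (a, c) \<in> nat_le \<longrightarrow> \<bar>0 - inf \<bar>X c - l\<bar> y\<bar> \<le> b"
        using y by (intro bexI[of _ m]) (auto simp: z_def simp del: neg_inf_eq_sup)
    qed
  qed
  then have "uo_conv G nat_le X l" using lG XG by (auto simp: uo_conv_def net_in_def)
  then show "l \<in> suo_adh G A" using lG XA unfolding suo_adh_def by blast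
qed

section \<open>Comparison of the adherences and of the topologies\<close>

lemma limit_in_closure_of:
  assumes "net_in A r x" "uo_conv G r x l"
  shows "l \<in> \<tau> closure_of A"
proof -
  have r: "directed r" using assms(1) by (simp add: net_in_def)
  have lim: "limitin \<tau> x l (tails r)" using uo_Lebesgue_any_index[OF uo_Lebesgue assms(2)] .
  have "\<exists>a\<in>A. a \<in> U" if U: "l \<in> U" "openin \<tau> U" for U
  proof -
    have "eventually (\<lambda>i. x i \<in> U) (tails r)" using lim U by (simp add: limitin_def)
    then obtain a where a: "a \<in> Field r" "\<forall>c. (a, c) \<in> r \<longrightarrow> x c \<in> U"
      unfolding eventually_tails[OF r] by blast
    then show ?thesis using directed_refl[OF r a(1)] assms(1) by (auto simp: net_in_def)
  qed
  then show ?thesis using lim by (auto simp: in_closure_of limitin_def)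
qed

text \<open>Two cycles of inclusions run from the closure through \<open>suo_adh\<close> back to the
  closure, one by way of \<open>uo_adh\<close> and the other by way of
  \<open>seq_adh\<close>.\<close>

lemma adh_eq_closure_of:
  assumes A: "A \<subseteq> G"
  shows "suo_adh G A = \<tau> closure_of A" "uo_adh G A = \<tau> closure_of A" "seq_adh \<tau> A = \<tau> closure_of A"
proof -
  have 1: "\<tau> closure_of A \<subseteq> suo_adh G A" by (rule closure_of_subset_suo_adh[OF A])
  have 2: "suo_adh G A \<subseteq> uo_adh G A"
  proof
    fix l assume "l \<in> suo_adh G A"
    then obtain x where "range x \<subseteq> A" "uo_conv G nat_le x l" by (auto simp: suo_adh_def)
    then show "l \<in> uo_adh G A" by (intro uo_adh_any_index[of A nat_le x]) (auto simp: net_in_def)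
  qed
  have 3: "uo_adh G A \<subseteq> \<tau> closure_of A" using limit_in_closure_of by (auto simp: uo_adh_def)
  have 4: "suo_adh G A \<subseteq> seq_adh \<tau> A"
    using uo_Lebesgue_any_index[OF uo_Lebesgue, of nat_le] unfolding suo_adh_def seq_adh_def tails_nat_le by auto
  have 5: "seq_adh \<tau> A \<subseteq> \<tau> closure_of A"
  proof
    fix l assume "l \<in> seq_adh \<tau> A"
    then obtain x where x: "range x \<subseteq> A" "limitin \<tau> x l sequentially" by (auto simp: seq_adh_def)
    have "\<exists>a\<in>A. a \<in> U" if U: "l \<in> U" "openin \<tau> U" for U
    proof -
      obtain n where "x n \<in> U"
        using x(2) U unfolding limitin_def eventually_sequentially by blast
      then show ?thesis using x(1) by blast
    qed
    then show "l \<in> \<tau> closure_of A" using x(2) by (auto simp: in_closure_of limitin_def)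
  qed
  show "suo_adh G A = \<tau> closure_of A" "uo_adh G A = \<tau> closure_of A" "seq_adh \<tau> A = \<tau> closure_of A"
    using 1 2 3 4 5 by blast+
qed

lemma closedin_iff_closure_of: "closedin \<tau> C \<longleftrightarrow> C \<subseteq> G \<and> \<tau> closure_of C = C"
  using closure_of_eq closedin_subset by (metis topspace)

text \<open>The closed sets are the fixed points of the respective adherence, and on subsets of
  \<open>G\<close> all these adherences agree with the closure in \<open>\<tau>\<close>.\<close>

lemma adh_topologies_eq: "suo_topology G = \<tau>" "uo_topology G = \<tau>" "seq_topology \<tau> = \<tau>"
proof -
  have eqI: "\<sigma> = \<tau>" if "\<And>C. closedin \<sigma> C \<longleftrightarrow> closedin \<tau> C" "topspace \<sigma> = G" for \<sigma>
    using that unfolding topology_eq openin_closedin_eq by simp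
  show "suo_topology G = \<tau>" "uo_topology G = \<tau>"
    by (rule eqI; use closedin_suo_topology[OF sublattice] closedin_uo_topology[OF sublattice]
      closedin_iff_closure_of adh_eq_closure_of in metis)+
  show "seq_topology \<tau> = \<tau>"
    by (rule eqI) (use closedin_seq_topology[of \<tau>] closedin_iff_closure_of adh_eq_closure_of topspace in metis)+
qed

end

section \<open>Existence of the topology\<close>

text \<open>For positive \<open>c\<close> the reverse inequality follows from
  \<open>abs_scaleR_nonneg\<close> for the factor \<open>inverse c\<close>.\<close>

lemma abs_scaleR_lattice:
  fixes x :: "'a::vector_lattice"
  assumes "0 \<le> c"
  shows "\<bar>c *\<^sub>R x\<bar> = c *\<^sub>R \<bar>x\<bar>"
proof (cases "c = 0")
  case False
  then have "c *\<^sub>R \<bar>x\<bar> = c *\<^sub>R \<bar>inverse c *\<^sub>R c *\<^sub>R x\<bar>" by simp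
  also have "\<dots> \<le> c *\<^sub>R inverse c *\<^sub>R \<bar>c *\<^sub>R x\<bar>"
    using assms abs_scaleR_nonneg[of "inverse c" "c *\<^sub>R x"] by (intro scaleR_left_mono) auto
  also have "\<dots> = \<bar>c *\<^sub>R x\<bar>" using False by simp
  finally show ?thesis using abs_scaleR_nonneg[OF assms, of x] by (rule order_antisym[rotated])
qed simp

section \<open>A vector space topology from a filter base of solid sets\<close>

locale solid_filter_base =
  fixes G :: "'a::vector_lattice set" and B :: "'a set set"
  assumes sublattice: "vector_sublattice G" and nonempty: "B \<noteq> {}"
    and solid: "V \<in> B \<Longrightarrow> solid_in G V" and zero: "V \<in> B \<Longrightarrow> 0 \<in> V"
    and Int: "V \<in> B \<Longrightarrow> W \<in> B \<Longrightarrow> \<exists>U\<in>B. U \<subseteq> V \<inter> W"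
    and halve: "V \<in> B \<Longrightarrow> \<exists>W\<in>B. \<forall>x\<in>W. \<forall>y\<in>W. x + y \<in> V"
    and absorb: "V \<in> B \<Longrightarrow> x \<in> G \<Longrightarrow> \<exists>c>0. c *\<^sub>R x \<in> V"
begin

lemmas closed [simp] = vector_sublatticeD[OF sublattice]

lemma solidD: "V \<in> B \<Longrightarrow> x \<in> V \<Longrightarrow> y \<in> G \<Longrightarrow> \<bar>y\<bar> \<le> \<bar>x\<bar> \<Longrightarrow> y \<in> V"
  using solid unfolding solid_in_def by blast

lemma base_subset: "V \<in> B \<Longrightarrow> x \<in> V \<Longrightarrow> x \<in> G"
  using solid unfolding solid_in_def by blast

definition base_topology :: "'a topology" where
  "base_topology = topology (\<lambda>U. U \<subseteq> G \<and> (\<forall>x\<in>U. \<exists>V\<in>B. \<forall>v\<in>V. x + v \<in> U))"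

lemma openin_base_topology:
  "openin base_topology U \<longleftrightarrow> U \<subseteq> G \<and> (\<forall>x\<in>U. \<exists>V\<in>B. \<forall>v\<in>V. x + v \<in> U)"
proof -
  have "istopology (\<lambda>U. U \<subseteq> G \<and> (\<forall>x\<in>U. \<exists>V\<in>B. \<forall>v\<in>V. x + v \<in> U))"
    unfolding istopology_def
  proof (intro conjI allI impI ballI)
    fix S T x
    assume S: "S \<subseteq> G \<and> (\<forall>x\<in>S. \<exists>V\<in>B. \<forall>v\<in>V. x + v \<in> S)"
      and T: "T \<subseteq> G \<and> (\<forall>x\<in>T. \<exists>V\<in>B. \<forall>v\<in>V. x + v \<in> T)"
    show "S \<inter> T \<subseteq> G" using S by blast
    assume "x \<in> S \<inter> T"
    then obtain V W where VW: "V \<in> B" "\<forall>v\<in>V. x + v \<in> S" "W \<in> B" "\<forall>v\<in>W. x + v \<in> T"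
      using S T by blast
    then obtain U where "U \<in> B" "U \<subseteq> V \<inter> W" using Int by blast
    then show "\<exists>V\<in>B. \<forall>v\<in>V. x + v \<in> S \<inter> T" using VW by blast
  next
    fix K assume "\<forall>S\<in>K. S \<subseteq> G \<and> (\<forall>x\<in>S. \<exists>V\<in>B. \<forall>v\<in>V. x + v \<in> S)"
    then show "\<Union>K \<subseteq> G" "\<And>x. x \<in> \<Union>K \<Longrightarrow> \<exists>V\<in>B. \<forall>v\<in>V. x + v \<in> \<Union>K" by (blast, meson Union_iff)
  qed
  then show ?thesis unfolding base_topology_def by (simp add: topology_inverse')
qed

lemma topspace_base_topology [simp]: "topspace base_topology = G"
proof -
  have "openin base_topology G"
    unfolding openin_base_topology using nonempty base_subset by fastforce
  then show ?thesis using openin_base_topology openin_subset openin_topspace by (metis order_antisym)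
qed

text \<open>Members of \<open>B\<close> are not assumed open, so the interior of \<open>A\<close> is
  built by hand as the set of all \<open>y\<close> with some translate \<open>y + V\<close> inside
  \<open>A\<close>. Halving \<open>V\<close> shows that it is open.\<close>

lemma interior_point:
  assumes "x \<in> G" "A \<subseteq> G" "V \<in> B" "\<And>v. v \<in> V \<Longrightarrow> x + v \<in> A"
  obtains U where "openin base_topology U" "x \<in> U" "U \<subseteq> A"
proof
  let ?U = "{y \<in> G. \<exists>V\<in>B. \<forall>v\<in>V. y + v \<in> A}"
  show "openin base_topology ?U"
    unfolding openin_base_topology
  proof (intro conjI ballI)
    fix y assume "y \<in> ?U"
    then obtain V where V: "y \<in> G" "V \<in> B" "\<forall>v\<in>V. y + v \<in> A" by blast
    obtain W where W: "W \<in> B" "\<forall>x\<in>W. \<forall>y\<in>W. x + y \<in> V" using halve[OF V(2)] by blast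
    have "y + w \<in> ?U" if "w \<in> W" for w
    proof -
      have "\<forall>v\<in>W. y + w + v \<in> A" using V(3) W(2) that by (simp add: add.assoc)
      then show ?thesis using W(1) V(1) base_subset[OF W(1) that] by auto
    qed
    then show "\<exists>V\<in>B. \<forall>v\<in>V. y + v \<in> ?U" using W(1) by blast
  qed auto
  show "x \<in> ?U" using assms by blast
  show "?U \<subseteq> A"
  proof
    fix y assume "y \<in> ?U"
    then obtain V where "V \<in> B" "\<forall>v\<in>V. y + v \<in> A" by blast
    then show "y \<in> A" using zero[of V] by force
  qed
qed

lemma open_translate:
  assumes "x \<in> G" "V \<in> B"
  obtains U where "openin base_topology U" "x \<in> U" "\<And>y. y \<in> U \<Longrightarrow> y - x \<in> V"
proof -
  obtain U where U: "openin base_topology U" "x \<in> U" "U \<subseteq> {y \<in> G. y - x \<in> V}"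
    by (rule interior_point[of x "{y \<in> G. y - x \<in> V}" V]) (use assms base_subset in auto)
  show thesis by (rule that[OF U(1,2)]) (use U(3) in auto)
qed

text \<open>Halving \<open>k\<close> times handles the factor \<open>2 ^ k\<close>, and solidity
  takes care of every factor of smaller absolute value.\<close>

lemma base_dilate:
  assumes "V \<in> B"
  obtains W where "W \<in> B" "\<And>c w. \<bar>c\<bar> \<le> 2 ^ k \<Longrightarrow> w \<in> W \<Longrightarrow> c *\<^sub>R w \<in> V"
proof -
  have "\<exists>W\<in>B. \<forall>w\<in>W. 2 ^ k *\<^sub>R w \<in> V"
  proof (induction k)
    case (Suc k)
    then obtain W where W: "W \<in> B" "\<forall>w\<in>W. 2 ^ k *\<^sub>R w \<in> V" by blast
    obtain W' where W': "W' \<in> B" "\<forall>x\<in>W'. \<forall>y\<in>W'. x + y \<in> W" using halve[OF W(1)] by blast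
    have "2 ^ Suc k *\<^sub>R w \<in> V" if "w \<in> W'" for w
    proof -
      have "2 ^ k *\<^sub>R (w + w) \<in> V" using W W' that by blast
      moreover have "2 ^ Suc k *\<^sub>R w = 2 ^ k *\<^sub>R (w + w)"
        by (simp add: scaleR_2[symmetric] mult.commute)
      ultimately show ?thesis by simp
    qed
    then show ?case using W'(1) by blast
  qed (use assms in auto)
  then obtain W where W: "W \<in> B" "\<forall>w\<in>W. 2 ^ k *\<^sub>R w \<in> V" by blast
  have "c *\<^sub>R w \<in> V" if c: "\<bar>c\<bar> \<le> 2 ^ k" and w: "w \<in> W" for c w
  proof (rule solidD[OF assms])
    show "2 ^ k *\<^sub>R w \<in> V" using W w by blast
    show "c *\<^sub>R w \<in> G" using base_subset[OF W(1) w] by simp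
    have "\<bar>c *\<^sub>R w\<bar> \<le> \<bar>c\<bar> *\<^sub>R \<bar>w\<bar>" by (rule abs_scaleR_le)
    also have "\<dots> \<le> 2 ^ k *\<^sub>R \<bar>w\<bar>" using c by (intro scaleR_right_mono) auto
    also have "\<dots> = \<bar>2 ^ k *\<^sub>R w\<bar>" by (rule abs_scaleR_lattice[symmetric]) simp
    finally show "\<bar>c *\<^sub>R w\<bar> \<le> \<bar>2 ^ k *\<^sub>R w\<bar>" .
  qed
  then show thesis using that W(1) by blast
qed

lemma continuous_map_base_topology_add:
  "continuous_map (prod_topology base_topology base_topology) base_topology (\<lambda>(x, y). x + y)"
  unfolding continuous_map_def
proof (intro conjI allI impI)
  fix U assume U: "openin base_topology U"
  show "openin (prod_topology base_topology base_topology)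
    {p \<in> topspace (prod_topology base_topology base_topology). (case p of (x, y) \<Rightarrow> x + y) \<in> U}"
    (is "openin _ ?S")
    unfolding openin_prod_topology_alt
  proof (intro allI impI)
    fix x y assume "(x, y) \<in> ?S"
    then have xy: "x \<in> G" "y \<in> G" "x + y \<in> U" by auto
    then obtain V where V: "V \<in> B" "\<forall>v\<in>V. x + y + v \<in> U" using U unfolding openin_base_topology by blast
    obtain W where W: "W \<in> B" "\<forall>x\<in>W. \<forall>y\<in>W. x + y \<in> V" using halve[OF V(1)] by blast
    obtain S where S: "openin base_topology S" "x \<in> S" "\<And>z. z \<in> S \<Longrightarrow> z - x \<in> W"
      using open_translate[OF xy(1) W(1)] by blast
    obtain T where T: "openin base_topology T" "y \<in> T" "\<And>z. z \<in> T \<Longrightarrow> z - y \<in> W"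
      using open_translate[OF xy(2) W(1)] by blast
    have "s + t \<in> U" if "s \<in> S" "t \<in> T" for s t
    proof -
      have "(s - x) + (t - y) \<in> V" using W(2) S(3) T(3) that by blast
      then have "x + y + ((s - x) + (t - y)) \<in> U" using V(2) by blast
      then show ?thesis by (simp add: algebra_simps)
    qed
    moreover have "S \<subseteq> G" "T \<subseteq> G" using S T by (auto simp: openin_base_topology)
    ultimately have "S \<times> T \<subseteq> ?S" by auto
    then show "\<exists>S T. openin base_topology S \<and> openin base_topology T \<and> x \<in> S \<and> y \<in> T \<and> S \<times> T \<subseteq> ?S"
      using S T by blast
  qed
qed auto

lemma continuous_map_base_topology_scaleR:
  "continuous_map (prod_topology euclideanreal base_topology) base_topology (\<lambda>(c, x). c *\<^sub>R x)"
  unfolding continuous_map_def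
proof (intro conjI allI impI)
  fix U assume U: "openin base_topology U"
  show "openin (prod_topology euclideanreal base_topology)
    {p \<in> topspace (prod_topology euclideanreal base_topology). (case p of (c, x) \<Rightarrow> c *\<^sub>R x) \<in> U}"
    (is "openin _ ?S")
    unfolding openin_prod_topology_alt
  proof (intro allI impI)
    fix c :: real and x assume "(c, x) \<in> ?S"
    then have x: "x \<in> G" "c *\<^sub>R x \<in> U" by auto
    then obtain V where V: "V \<in> B" "\<forall>v\<in>V. c *\<^sub>R x + v \<in> U" using U unfolding openin_base_topology by blast
    obtain W where W: "W \<in> B" "\<forall>x\<in>W. \<forall>y\<in>W. x + y \<in> V" using halve[OF V(1)] by blast
    obtain e where e: "e > 0" "e *\<^sub>R x \<in> W" using absorb[OF W(1) x(1)] by blast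
    obtain k where k: "\<bar>c\<bar> + 1 < 2 ^ k" using real_arch_pow[of 2 "\<bar>c\<bar> + 1"] by auto
    obtain W' where W': "W' \<in> B" "\<And>c w. \<bar>c\<bar> \<le> 2 ^ k \<Longrightarrow> w \<in> W' \<Longrightarrow> c *\<^sub>R w \<in> W"
      using base_dilate[OF W(1)] by metis
    obtain T where T: "openin base_topology T" "x \<in> T" "\<And>z. z \<in> T \<Longrightarrow> z - x \<in> W'"
      using open_translate[OF x(1) W'(1)] by blast
    \<comment> \<open>In \<open>b t - c x = (b - c) x + b (t - x)\<close>, radius \<open>e\<close>
      puts the first summand into \<open>W\<close> by solidity; radius 1 gives
      \<open>\<bar>b\<bar> \<le> 2 ^ k\<close>, which puts the second one there.\<close>
    let ?I = "ball c (min e 1)"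
    have "b *\<^sub>R t \<in> U" if b: "b \<in> ?I" and t: "t \<in> T" for b t
    proof -
      have be: "\<bar>b - c\<bar> \<le> e" "\<bar>b - c\<bar> \<le> 1" using b by (auto simp: dist_real_def)
      have "(b - c) *\<^sub>R x \<in> W"
      proof (rule solidD[OF W(1) e(2)])
        have "\<bar>(b - c) *\<^sub>R x\<bar> \<le> \<bar>b - c\<bar> *\<^sub>R \<bar>x\<bar>" by (rule abs_scaleR_le)
        also have "\<dots> \<le> e *\<^sub>R \<bar>x\<bar>" using be by (intro scaleR_right_mono) auto
        also have "\<dots> = \<bar>e *\<^sub>R x\<bar>" using e by (simp add: abs_scaleR_lattice)
        finally show "\<bar>(b - c) *\<^sub>R x\<bar> \<le> \<bar>e *\<^sub>R x\<bar>" .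
      qed (use x in simp)
      moreover have "b *\<^sub>R (t - x) \<in> W" by (rule W'(2)) (use be k T(3)[OF t] in auto)
      ultimately have "(b - c) *\<^sub>R x + b *\<^sub>R (t - x) \<in> V" using W(2) by blast
      then have "c *\<^sub>R x + ((b - c) *\<^sub>R x + b *\<^sub>R (t - x)) \<in> U" using V(2) by blast
      then show ?thesis by (simp add: algebra_simps)
    qed
    moreover have "T \<subseteq> G" using T by (auto simp: openin_base_topology)
    ultimately have "?I \<times> T \<subseteq> ?S" by auto
    moreover have "c \<in> ?I" using e by simp
    ultimately show "\<exists>S T. openin euclideanreal S \<and> openin base_topology T \<and> c \<in> S \<and> x \<in> T \<and> S \<times> T \<subseteq> ?S"
      using T(1,2) by (intro exI[of _ ?I] exI[of _ T]) simp
  qed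
qed auto

lemma locally_solid_base_topology: "locally_solid_linear_topology G base_topology"
  unfolding locally_solid_linear_topology_def
proof (intro conjI continuous_map_base_topology_add continuous_map_base_topology_scaleR)
  show "neighbourhood_base_at 0 (solid_in G) base_topology"
    unfolding neighbourhood_base_at_def
  proof (intro allI impI, elim conjE)
    fix W assume W: "openin base_topology W" "0 \<in> W"
    then obtain V where V: "V \<in> B" "\<forall>v\<in>V. 0 + v \<in> W" unfolding openin_base_topology by blast
    obtain U where "openin base_topology U" "0 \<in> U" "U \<subseteq> V"
      by (rule interior_point[of 0 V V]) (use V base_subset in auto)
    then show "\<exists>U V. openin base_topology U \<and> solid_in G V \<and> 0 \<in> U \<and> U \<subseteq> V \<and> V \<subseteq> W"
      using V solid[OF V(1)] by auto
  qed
qed simp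

lemma Hausdorff_base_topology:
  assumes sep: "\<And>x. x \<in> G \<Longrightarrow> x \<noteq> 0 \<Longrightarrow> \<exists>V\<in>B. x \<notin> V"
  shows "Hausdorff_space base_topology"
  unfolding Hausdorff_space_def
proof (intro allI impI, elim conjE)
  fix x y assume xy: "x \<in> topspace base_topology" "y \<in> topspace base_topology" "x \<noteq> y"
  then obtain V where V: "V \<in> B" "x - y \<notin> V" using sep[of "x - y"] by auto
  obtain W where W: "W \<in> B" "\<forall>x\<in>W. \<forall>y\<in>W. x + y \<in> V" using halve[OF V(1)] by blast
  obtain S where S: "openin base_topology S" "x \<in> S" "\<And>z. z \<in> S \<Longrightarrow> z - x \<in> W"
    using open_translate[of x, OF _ W(1)] xy by auto
  obtain T where T: "openin base_topology T" "y \<in> T" "\<And>z. z \<in> T \<Longrightarrow> z - y \<in> W"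
    using open_translate[of y, OF _ W(1)] xy by auto
  \<comment> \<open>A common point would give \<open>x - y = (x - z) + (z - y)\<close> with both
    summands in \<open>W\<close>, hence \<open>x - y\<close> in \<open>V\<close>.\<close>
  have False if z: "z \<in> S" "z \<in> T" for z
  proof -
    have "z - x \<in> W" by (rule S(3)[OF z(1)])
    then have "x - z \<in> W"
      using solidD[OF W(1) \<open>z - x \<in> W\<close>, of "x - z"] base_subset[OF W(1) \<open>z - x \<in> W\<close>] closed(5)[of "z - x"]
      by (simp add: abs_minus_commute)
    then have "(x - z) + (z - y) \<in> V" using W(2) T(3)[OF z(2)] by blast
    then show False using V(2) by simp
  qed
  then show "\<exists>U V. openin base_topology U \<and> openin base_topology V \<and> x \<in> U \<and> y \<in> V \<and> disjnt U V"
    using S T unfolding disjnt_iff by blast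
qed

lemma limitin_base_topology:
  assumes "l \<in> G" "\<And>V. V \<in> B \<Longrightarrow> eventually (\<lambda>a. x a - l \<in> V) \<F>"
  shows "limitin base_topology x l \<F>"
  unfolding limitin_def
proof (intro conjI allI impI)
  fix U assume "openin base_topology U \<and> l \<in> U"
  then obtain V where V: "V \<in> B" "\<forall>v\<in>V. l + v \<in> U" unfolding openin_base_topology by blast
  show "eventually (\<lambda>a. x a \<in> U) \<F>"
    using assms(2)[OF V(1)]
  proof eventually_elim
    case (elim a)
    then have "l + (x a - l) \<in> U" using V(2) by blast
    then show ?case by simp
  qed
qed (use assms in simp)

end

section \<open>Order ideals and order continuous functionals\<close>

lemma order_idealD:
  assumes "order_ideal F"
  shows "0 \<in> F" "\<And>x y. x \<in> F \<Longrightarrow> \<bar>y\<bar> \<le> \<bar>x\<bar> \<Longrightarrow> y \<in> F" "\<And>x. x \<in> F \<Longrightarrow> \<bar>x\<bar> \<in> F"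
    "\<And>x y. y \<in> F \<Longrightarrow> 0 \<le> x \<Longrightarrow> x \<le> y \<Longrightarrow> x \<in> F"
proof -
  show "0 \<in> F" using assms by (simp add: order_ideal_def subspace_0)
  show s: "y \<in> F" if "x \<in> F" "\<bar>y\<bar> \<le> \<bar>x\<bar>" for x y
    using assms that unfolding order_ideal_def solid_in_def by blast
  show "\<bar>x\<bar> \<in> F" if "x \<in> F" for x using s[OF that, of "\<bar>x\<bar>"] by simp
  show "x \<in> F" if "y \<in> F" "0 \<le> x" "x \<le> y" for x y
    using s[OF that(1), of x] that by simp
qed

lemma order_ideal_vector_sublattice:
  assumes "order_ideal F"
  shows "vector_sublattice F"
proof -
  note F = order_idealD[OF assms]
  have sub: "subspace F" using assms by (simp add: order_ideal_def)
  have le: "z \<in> F" if "x \<in> F" "y \<in> F" "\<bar>z\<bar> \<le> \<bar>x\<bar> + \<bar>y\<bar>" for x y z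
    using F(2)[OF subspace_add[OF sub F(3)[OF that(1)] F(3)[OF that(2)]], of z] that(3) by simp
  have "\<bar>sup x y\<bar> \<le> \<bar>x\<bar> + \<bar>y\<bar> \<and> \<bar>inf x y\<bar> \<le> \<bar>x\<bar> + \<bar>y\<bar>" for x y :: 'a
  proof -
    have x: "x \<le> \<bar>x\<bar> + \<bar>y\<bar>" "- x \<le> \<bar>x\<bar> + \<bar>y\<bar>"
      by (simp_all add: add_increasing2 abs_ge_self abs_ge_minus_self)
    have y: "y \<le> \<bar>x\<bar> + \<bar>y\<bar>" "- y \<le> \<bar>x\<bar> + \<bar>y\<bar>"
      by (simp_all add: add_increasing abs_ge_self abs_ge_minus_self)
    show ?thesis using x y by (auto intro!: abs_leI le_infI1 le_supI)
  qed
  then show ?thesis using sub le unfolding vector_sublattice_def by blast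
qed

text \<open>For \<open>0 \<le> a\<close> in the domain of a functional \<open>f\<close> this is the
  bound \<open>e\<close> on its modulus at \<open>a\<close>, the supremum of all
  \<open>\<bar>f v\<bar>\<close> with \<open>\<bar>v\<bar> \<le> a\<close>. As a bound it requires
  no construction of the modulus.\<close>

definition small_on :: "('a::vector_lattice \<Rightarrow> real) \<Rightarrow> 'a \<Rightarrow> real \<Rightarrow> bool" where
  "small_on f a e \<longleftrightarrow> (\<forall>v. \<bar>v\<bar> \<le> a \<longrightarrow> \<bar>f v\<bar> \<le> e)"

lemma small_on_mono: "small_on f a e \<Longrightarrow> b \<le> a \<Longrightarrow> e \<le> e' \<Longrightarrow> small_on f b e'"
  unfolding small_on_def by (meson order_trans)

text \<open>Applying order continuity to the net of all pairs \<open>(d, v)\<close> with \<open>\<bar>v\<bar> \<le> d\<close> gives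
  uniformity over order intervals, which replaces the order continuity of the modulus of \<open>f\<close>.\<close>

lemma order_continuous_functional_uniform:
  assumes F: "order_ideal F" and f: "order_continuous_functional F f"
    and D: "decreasing_to_zero F D" and e: "0 < e"
  obtains d where "d \<in> D" "small_on f d e"
proof -
  define I where "I = {p. fst p \<in> D \<and> \<bar>snd p\<bar> \<le> fst p}"
  define r where "r = {(p, q). p \<in> I \<and> q \<in> I \<and> fst q \<le> fst p}"
  have D': "D \<subseteq> F" "\<And>d. d \<in> D \<Longrightarrow> 0 \<le> d" "D \<noteq> {}" using D by (auto simp: decreasing_to_zero_def inf_in_def)
  have I0: "(d, 0) \<in> I" if "d \<in> D" for d using that D' by (simp add: I_def)
  have IF: "snd p \<in> F" if "p \<in> I" for p
    using that D' order_idealD(2)[OF F, of "fst p" "snd p"] by (auto simp: I_def)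
  have ub: "\<exists>c. (p, c) \<in> r \<and> (q, c) \<in> r" if "p \<in> I" "q \<in> I" for p q
  proof -
    obtain d where d: "d \<in> D" "d \<le> fst p" "d \<le> fst q"
      using decreasing_to_zero_directed[OF D, of "fst p" "fst q"] \<open>p \<in> I\<close> \<open>q \<in> I\<close>
      unfolding I_def by blast
    then show ?thesis using that I0 by (intro exI[of _ "(d, 0)"]) (simp add: r_def)
  qed
  have "I \<noteq> {}" using I0 D'(3) by blast
  moreover have "r \<subseteq> I \<times> I" "\<And>p. p \<in> I \<Longrightarrow> (p, p) \<in> r" "trans r" by (auto simp: r_def trans_def)
  ultimately have r: "directed r" "Field r = I" using directedI[of I r] ub by blast+
  have "order_conv F r snd 0"
  proof (rule order_convI_any_index[OF _ order_idealD(1)[OF F] decreases_to_ge_rel(1)[OF D]])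
    show "net_in F r snd" using r IF by (auto simp: net_in_def)
    fix b assume "b \<in> Field (ge_rel D)"
    then have b: "b \<in> D" by (simp add: decreases_to_ge_rel(3)[OF D])
    have "\<bar>0 - snd c\<bar> \<le> b" if "((b, 0), c) \<in> r" for c
      using that by (auto simp: r_def I_def intro: order_trans)
    then show "\<exists>a\<in>Field r. \<forall>c. (a, c) \<in> r \<longrightarrow> \<bar>0 - snd c\<bar> \<le> b" using I0[OF b] r(2) by blast
  qed
  then have "((\<lambda>p. f (snd p)) \<longlongrightarrow> 0) (tails r)" by (rule order_continuous_functional_any_index[OF f])
  then have "eventually (\<lambda>p. dist (f (snd p)) 0 < e) (tails r)" using e by (rule tendstoD)
  then obtain p where p: "p \<in> I" "\<forall>q. (p, q) \<in> r \<longrightarrow> dist (f (snd q)) 0 < e"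
    unfolding eventually_tails[OF r(1)] r(2) by blast
  have "\<bar>f v\<bar> \<le> e" if "\<bar>v\<bar> \<le> fst p" for v
  proof -
    \<comment> \<open>The order on \<open>I\<close> compares first components only, so every such
      pair lies beyond \<open>p\<close>, whatever \<open>v\<close> is.\<close>
    have "(fst p, v) \<in> I" using p(1) that by (simp add: I_def)
    then have "(p, (fst p, v)) \<in> r" using p(1) by (simp add: r_def)
    then show ?thesis using p(2) by fastforce
  qed
  then show thesis using that[of "fst p"] p(1) by (simp add: I_def small_on_def)
qed

text \<open>Subadditivity of the modulus: Riesz decomposition splits each \<open>v\<close> into
  parts dominated by \<open>a\<close> and by \<open>b\<close>.\<close>

lemma small_on_add:
  assumes F: "order_ideal F" and f: "order_continuous_functional F f"
    and "a \<in> F" "b \<in> F" "0 \<le> a" "0 \<le> b" "small_on f a e" "small_on f b e'"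
  shows "small_on f (a + b) (e + e')"
  unfolding small_on_def
proof (intro allI impI)
  fix v assume "\<bar>v\<bar> \<le> a + b"
  then obtain v1 v2 where v: "v = v1 + v2" "\<bar>v1\<bar> \<le> a" "\<bar>v2\<bar> \<le> b"
    using Riesz_decomposition assms by metis
  have "v1 \<in> F" "v2 \<in> F" using order_idealD(2)[OF F, of a v1] order_idealD(2)[OF F, of b v2] v assms by auto
  then have "f v = f v1 + f v2" using f v(1) unfolding order_continuous_functional_def by blast
  moreover have "\<bar>f v1\<bar> \<le> e" "\<bar>f v2\<bar> \<le> e'" using assms(7,8) v unfolding small_on_def by blast+
  ultimately show "\<bar>f v\<bar> \<le> e + e'" by linarith
qed

text \<open>By the Archimedean property the truncated fractions of \<open>\<bar>x\<bar>\<close>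
  decrease to 0 in \<open>F\<close>, so \<open>f\<close> becomes uniformly small on them. The bound
  for all smaller factors allows finitely many functionals to share one \<open>c\<close>.\<close>

lemma small_on_scale:
  fixes F :: "'a::archimedean_vector_lattice set"
  assumes F: "order_ideal F" and f: "order_continuous_functional F f"
    and u: "u \<in> F" "0 \<le> u" and e: "0 < e"
  shows "\<exists>c>0. \<forall>b. 0 < b \<longrightarrow> b \<le> c \<longrightarrow> small_on f (inf \<bar>b *\<^sub>R x\<bar> u) e"
proof -
  let ?d = "\<lambda>n. inf (inverse (real (Suc n)) *\<^sub>R \<bar>x\<bar>) u"
  have d: "0 \<le> ?d n" "?d n \<in> F" for n
  proof -
    show "0 \<le> ?d n" using u by (simp add: scaleR_nonneg_nonneg)
    then show "?d n \<in> F" by (rule order_idealD(4)[OF F u(1)]) simp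
  qed
  have mono: "?d n \<le> ?d m" if "m \<le> n" for m n
  proof -
    have "inverse (real (Suc n)) *\<^sub>R \<bar>x\<bar> \<le> inverse (real (Suc m)) *\<^sub>R \<bar>x\<bar>"
      using that by (intro scaleR_right_mono) (auto intro: le_imp_inverse_le)
    then show ?thesis by (rule inf_mono) simp
  qed
  have "inf_in F (range ?d) 0"
  proof (rule inf_in_zeroI[OF order_ideal_vector_sublattice[OF F]])
    fix g assume g: "0 \<le> g" "\<And>d. d \<in> range ?d \<Longrightarrow> g \<le> d"
    show "g = 0"
    proof (rule archimedean[OF g(1)])
      fix n :: nat
      show "real n *\<^sub>R g \<le> \<bar>x\<bar>"
      proof (cases n)
        case (Suc m)
        have "g \<le> inverse (real n) *\<^sub>R \<bar>x\<bar>" using g(2)[of "?d m"] unfolding Suc by auto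
        then have "real n *\<^sub>R g \<le> real n *\<^sub>R inverse (real n) *\<^sub>R \<bar>x\<bar>" by (intro scaleR_left_mono) auto
        then show ?thesis using Suc by simp
      qed simp
    qed
  qed (use d in auto)
  moreover have "\<exists>c\<in>range ?d. c \<le> ?d m \<and> c \<le> ?d n" for m n
    using mono[of m "max m n"] mono[of n "max m n"] by (intro bexI[of _ "?d (max m n)"]) auto
  ultimately have "decreasing_to_zero F (range ?d)" using d(2) unfolding decreasing_to_zero_def by blast
  then obtain n where n: "small_on f (?d n) e"
    using order_continuous_functional_uniform[OF F f _ e] by blast
  have "small_on f (inf \<bar>b *\<^sub>R x\<bar> u) e" if "0 < b" "b \<le> inverse (real (Suc n))" for b
  proof (rule small_on_mono[OF n _ order_refl])
    have "\<bar>b *\<^sub>R x\<bar> \<le> inverse (real (Suc n)) *\<^sub>R \<bar>x\<bar>"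
      using that by (simp add: abs_scaleR_lattice scaleR_right_mono)
    then show "inf \<bar>b *\<^sub>R x\<bar> u \<le> ?d n" by (rule inf_mono) simp
  qed
  then show ?thesis by (intro exI[of _ "inverse (real (Suc n))"]) auto
qed

text \<open>The truncation \<open>u\<close> need not lie in \<open>G\<close>, so uo-convergence in
  \<open>G\<close> cannot be tested at \<open>u\<close>. Instead \<open>u\<close> is approximated
  through the elements \<open>inf g u\<close> with \<open>g\<close> in the positive cone of
  \<open>G\<close>: up to some \<open>d\<close> on which \<open>f\<close> is small, one
  \<open>g\<close> serves for all of them, and convergence is tested at that \<open>g\<close>.
  Regularity then carries the dominating net over to the whole space, and truncation at
  \<open>u\<close> into \<open>F\<close>.\<close>

lemma uo_conv_small_on:
  fixes F G :: "'a::archimedean_vector_lattice set"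
  assumes F: "order_ideal F" and f: "order_continuous_functional F f"
    and u: "u \<in> F" "0 \<le> u" and e: "0 < e"
    and reg: "regular_sublattice G" and x: "uo_conv G r x l"
  shows "eventually (\<lambda>a. small_on f (inf \<bar>x a - l\<bar> u) e) (tails r)"
proof -
  have G: "vector_sublattice G" using reg by (simp add: regular_sublattice_def)
  note Gc = vector_sublatticeD[OF G]
  note Fl = order_ideal_vector_sublattice[OF F]
  have r: "directed r" and xG: "\<And>a. a \<in> Field r \<Longrightarrow> x a \<in> G" and l: "l \<in> G"
    using x by (auto simp: uo_conv_def net_in_def)
  define H where "H = {inf g u | g. g \<in> G \<and> 0 \<le> g}"
  have HF: "H \<subseteq> F" using order_idealD(4)[OF F u(1)] u(2) by (auto simp: H_def)
  have dirH: "\<exists>c\<in>H. a \<le> c \<and> b \<le> c" if ab: "a \<in> H" "b \<in> H" for a b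
  proof -
    obtain g h where gh: "a = inf g u" "b = inf h u" "g \<in> G" "0 \<le> g" "h \<in> G" "0 \<le> h"
      using ab by (auto simp: H_def)
    have "inf (sup g h) u \<in> H" using gh Gc(6) by (auto simp: H_def intro: le_supI1)
    moreover have "a \<le> inf (sup g h) u" "b \<le> inf (sup g h) u" using gh by (auto intro: le_infI1)
    ultimately show ?thesis by blast
  qed
  have "inf 0 u \<in> H" using Gc(1) by (auto simp: H_def)
  then have "decreasing_to_zero F {b - s | b s. b \<in> F \<and> (\<forall>t\<in>H. t \<le> b) \<and> s \<in> H}"
    by (intro upper_bounds_minus_decreasing[OF Fl HF _ dirH u(1)]) (auto simp: H_def)
  from order_continuous_functional_uniform[OF F f this half_gt_zero[OF e]]
  obtain d where d: "d \<in> {b - s | b s. b \<in> F \<and> (\<forall>t\<in>H. t \<le> b) \<and> s \<in> H}" "small_on f d (e / 2)" .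
  then obtain b s where bs: "d = b - s" "b \<in> F" "\<And>t. t \<in> H \<Longrightarrow> t \<le> b" "s \<in> H" by blast
  obtain g where g: "s = inf g u" "g \<in> G" "0 \<le> g" using bs(4) by (auto simp: H_def)
  have "order_conv G r (\<lambda>a. inf \<bar>x a - l\<bar> g) 0" using x g by (simp add: uo_conv_def)
  then obtain q :: "'a index rel" and y where y: "decreases_to G q y 0"
    and dom: "\<And>b. b \<in> Field q \<Longrightarrow> \<exists>a\<in>Field r. \<forall>c. (a, c) \<in> r \<longrightarrow> \<bar>0 - inf \<bar>x c - l\<bar> g\<bar> \<le> y b"
    unfolding order_conv_def by blast
  have Y: "decreasing_to_zero UNIV (y ` Field q)"
    by (rule regular_decreasing_to_zero[OF reg decreasing_to_zero_range[OF y]])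
  have y0: "0 \<le> y b" if "b \<in> Field q" for b
    using y that by (auto simp: decreases_to_def inf_in_def)
  have "decreasing_to_zero F ((\<lambda>d. inf d u) ` y ` Field q)"
  proof (rule decreasing_to_zero_inf[OF Y Fl u(2)])
    fix d assume "d \<in> y ` Field q"
    then have "0 \<le> d" using y0 by blast
    then show "inf d u \<in> F" by (intro order_idealD(4)[OF F u(1)]) (use u in auto)
  qed
  from order_continuous_functional_uniform[OF F f this half_gt_zero[OF e]]
  obtain k where k: "k \<in> Field q" "small_on f (inf (y k) u) (e / 2)" by blast
  obtain a where a: "a \<in> Field r" "\<And>c. (a, c) \<in> r \<Longrightarrow> \<bar>0 - inf \<bar>x c - l\<bar> g\<bar> \<le> y k"
    using dom[OF k(1)] by blast
  have "small_on f (inf \<bar>x c - l\<bar> u) e" if c: "(a, c) \<in> r" for c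
  proof -
    define z where "z = \<bar>x c - l\<bar>"
    have zG: "z \<in> G" "0 \<le> z" using xG[of c] l c Gc(3,8) unfolding z_def by (auto intro: FieldI2)
    have zH: "inf z u \<in> H" using zG by (auto simp: H_def)
    \<comment> \<open>\<open>inf z u\<close> is the sum of \<open>inf (inf z u) s\<close>, which is
      at most \<open>inf (y k) u\<close> because \<open>s \<le> g\<close>, and
      \<open>sup (inf z u) s - s\<close>, which is at most \<open>b - s = d\<close>.\<close>
    have "inf z g \<le> y k" using a(2)[OF c] zG(2) g(3) by (simp add: z_def[symmetric] del: neg_inf_eq_sup)
    then have "inf (inf z u) s \<le> inf (y k) u"
      unfolding g(1) by (meson inf.boundedI inf.cobounded1 inf.cobounded2 order_trans)
    moreover have "inf z u - inf (inf z u) s = sup (inf z u) s - s" by (rule diff_inf_eq_sup_diff)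
    moreover have "sup (inf z u) s \<le> b" using bs(3)[OF zH] bs(3)[OF bs(4)] by simp
    ultimately have "inf z u \<le> inf (y k) u + d"
      unfolding bs(1) by (metis add_mono_thms_linordered_semiring(1) diff_add_cancel add.commute diff_right_mono)
    moreover have "small_on f (inf (y k) u + d) (e / 2 + e / 2)"
    proof (rule small_on_add[OF F f _ _ _ _ k(2) d(2)])
      show "0 \<le> inf (y k) u" using y0[OF k(1)] u by simp
      then show "inf (y k) u \<in> F" by (rule order_idealD(4)[OF F u(1)]) simp
      show "0 \<le> d" using bs by simp
      show "d \<in> F" using bs HF vector_sublatticeD(3)[OF Fl] by auto
    qed
    ultimately show ?thesis using small_on_mono unfolding z_def[symmetric] by fastforce
  qed
  then show ?thesis unfolding eventually_tails[OF r] using a(1) by blast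
qed

section \<open>The topology of the pseudonorms given by order continuous functionals\<close>

definition dual_ball ::
  "'a::vector_lattice set \<Rightarrow> (('a \<Rightarrow> real) \<times> 'a) set \<Rightarrow> real \<Rightarrow> 'a set" where
  "dual_ball G P e = {x \<in> G. \<forall>(f, u)\<in>P. small_on f (inf \<bar>x\<bar> u) e}"

definition dual_base :: "'a::vector_lattice set \<Rightarrow> 'a set \<Rightarrow> 'a set set" where
  "dual_base F G = {dual_ball G P e | P e. finite P \<and> 0 < e \<and>
     (\<forall>(f, u)\<in>P. order_continuous_functional F f \<and> u \<in> F \<and> 0 \<le> u)}"

lemma dual_baseI:
  assumes "finite P" "0 < e"
    "\<And>f u. (f, u) \<in> P \<Longrightarrow> order_continuous_functional F f \<and> u \<in> F \<and> 0 \<le> u"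
  shows "dual_ball G P e \<in> dual_base F G"
  unfolding dual_base_def using assms by blast

lemma solid_filter_base_dual_base:
  fixes F G :: "'a::archimedean_vector_lattice set"
  assumes F: "order_ideal F" and G: "vector_sublattice G"
  shows "solid_filter_base G (dual_base F G)"
proof
  note Gc = vector_sublatticeD[OF G]
  have f0: "f 0 = 0" if "order_continuous_functional F f" for f
    using that order_idealD(1)[OF F] unfolding order_continuous_functional_def
    by (metis add_cancel_right_right)
  show "vector_sublattice G" by fact
  have "dual_ball G {} 1 \<in> dual_base F G" by (rule dual_baseI) auto
  then show "dual_base F G \<noteq> {}" by blast
  fix V assume "V \<in> dual_base F G"
  then obtain P e where V: "V = dual_ball G P e" "finite P" "0 < e"
    and P: "\<And>f u. (f, u) \<in> P \<Longrightarrow> order_continuous_functional F f \<and> u \<in> F \<and> 0 \<le> u"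
    unfolding dual_base_def by blast
  show "solid_in G V"
    unfolding solid_in_def V dual_ball_def
    by (fastforce elim!: small_on_mono intro: le_infI1)
  have "\<bar>f 0\<bar> \<le> e" if "(f, u) \<in> P" for f u using f0[of f] P[OF that] V(3) by simp
  then show "0 \<in> V" unfolding V dual_ball_def small_on_def using Gc(1) P by (auto simp: inf_absorb1)
  show "\<exists>U\<in>dual_base F G. U \<subseteq> V \<inter> W" if "W \<in> dual_base F G" for W
  proof -
    obtain Q e' where W: "W = dual_ball G Q e'" "finite Q" "0 < e'"
      and Q: "\<And>f u. (f, u) \<in> Q \<Longrightarrow> order_continuous_functional F f \<and> u \<in> F \<and> 0 \<le> u"
      using \<open>W \<in> dual_base F G\<close> unfolding dual_base_def by blast
    have "dual_ball G (P \<union> Q) (min e e') \<in> dual_base F G"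
      by (rule dual_baseI) (use V W P Q in auto)
    moreover have "dual_ball G (P \<union> Q) (min e e') \<subseteq> V \<inter> W"
      unfolding V W dual_ball_def by (fastforce elim: small_on_mono)
    ultimately show ?thesis by blast
  qed
  show "\<exists>W\<in>dual_base F G. \<forall>x\<in>W. \<forall>y\<in>W. x + y \<in> V"
  proof (intro bexI ballI)
    show "dual_ball G P (e / 2) \<in> dual_base F G" by (rule dual_baseI) (use V P in auto)
    fix x y assume xy: "x \<in> dual_ball G P (e / 2)" "y \<in> dual_ball G P (e / 2)"
    have "small_on f (inf \<bar>x + y\<bar> u) e" if fu: "(f, u) \<in> P" for f u
    proof -
      have u: "u \<in> F" "0 \<le> u" and f: "order_continuous_functional F f" using P[OF fu] by auto
      have "small_on f (inf \<bar>x\<bar> u + inf \<bar>y\<bar> u) (e / 2 + e / 2)"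
        using xy fu u unfolding dual_ball_def
        by (intro small_on_add[OF F f]) (auto intro: order_idealD(4)[OF F u(1)])
      then show ?thesis by (rule small_on_mono) (use inf_abs_add_le[OF u(2)] in auto)
    qed
    then show "x + y \<in> V" using xy Gc(2) unfolding V dual_ball_def by auto
  qed
  show "\<exists>c>0. c *\<^sub>R x \<in> V" if x: "x \<in> G" for x
  proof -
    \<comment> \<open>Quantifying over all smaller factors lets the induction over \<open>P\<close>
      take the minimum of two bounds.\<close>
    have "\<exists>c>0. \<forall>b. 0 < b \<longrightarrow> b \<le> c \<longrightarrow> (\<forall>(f, u)\<in>P. small_on f (inf \<bar>b *\<^sub>R x\<bar> u) e)"
      using V(2) P
    proof (induction P rule: finite_induct)
      case (insert p P)
      obtain f u where p: "p = (f, u)" by force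
      obtain c where c: "c > 0" "\<And>b. 0 < b \<Longrightarrow> b \<le> c \<Longrightarrow> \<forall>(f, u)\<in>P. small_on f (inf \<bar>b *\<^sub>R x\<bar> u) e"
        using insert by blast
      obtain c' where c': "c' > 0" "\<And>b. 0 < b \<Longrightarrow> b \<le> c' \<Longrightarrow> small_on f (inf \<bar>b *\<^sub>R x\<bar> u) e"
        using small_on_scale[OF F, of f u e x] insert.prems[of f u] V(3) p by auto
      show ?case using c c' p by (intro exI[of _ "min c c'"]) auto
    qed (auto intro: exI[of _ 1])
    then obtain c where c: "c > 0" "\<forall>(f, u)\<in>P. small_on f (inf \<bar>c *\<^sub>R x\<bar> u) e" by blast
    then show ?thesis using Gc(4)[OF x] unfolding V dual_ball_def by blast
  qed
qed

lemma Hausdorff_uo_Lebesgue_topology_exists: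
  fixes F G :: "'a::archimedean_vector_lattice set"
  assumes F: "order_ideal F" "order_dense F" "oc_dual_separates_points F" and reg: "regular_sublattice G"
  shows "\<exists>\<tau>. Hausdorff_uo_Lebesgue_topology G \<tau>"
proof -
  have G: "vector_sublattice G" using reg by (simp add: regular_sublattice_def)
  interpret solid_filter_base G "dual_base F G" by (rule solid_filter_base_dual_base[OF F(1) G])
  have "Hausdorff_space base_topology"
  proof (rule Hausdorff_base_topology)
    fix x assume x: "x \<in> G" "x \<noteq> 0"
    then have "0 < \<bar>x\<bar>" by (simp add: order_less_le)
    then obtain v where v: "v \<in> F" "0 < v" "v \<le> \<bar>x\<bar>" using F(2) unfolding order_dense_def by blast
    then obtain f where f: "order_continuous_functional F f" "f v \<noteq> f 0"
      using F(3) order_idealD(1)[OF F(1)] unfolding oc_dual_separates_points_def by (metis less_irrefl)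
    then have "f 0 = 0" using order_idealD(1)[OF F(1)] unfolding order_continuous_functional_def
      by (metis add_cancel_right_right)
    then have e: "0 < \<bar>f v\<bar> / 2" using f by simp
    \<comment> \<open>Truncating at \<open>v\<close> itself gives
      \<open>inf \<bar>x\<bar> v = v\<close>, and there \<open>f\<close> exceeds half of
      \<open>\<bar>f v\<bar>\<close>.\<close>
    let ?V = "dual_ball G {(f, v)} (\<bar>f v\<bar> / 2)"
    have "x \<notin> ?V"
    proof
      assume "x \<in> ?V"
      then have "small_on f v (\<bar>f v\<bar> / 2)" using v(3) by (simp add: dual_ball_def inf_absorb2)
      then have "\<bar>f v\<bar> \<le> \<bar>f v\<bar> / 2" unfolding small_on_def using v(2) by simp
      then show False using e by simp
    qed
    moreover have "?V \<in> dual_base F G" by (rule dual_baseI) (use e f v in auto)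
    ultimately show "\<exists>V\<in>dual_base F G. x \<notin> V" by blast
  qed
  moreover have "limitin base_topology x l (tails r)" if x: "uo_conv G r x l" for r :: "'a index rel" and x l
  proof (rule limitin_base_topology)
    show l: "l \<in> G" using x by (simp add: uo_conv_def)
    have r: "directed r" and xG: "\<And>a. a \<in> Field r \<Longrightarrow> x a \<in> G" using x by (auto simp: uo_conv_def net_in_def)
    have ev: "eventually (\<lambda>a. x a - l \<in> G) (tails r)"
    proof -
      obtain a where "a \<in> Field r" using r unfolding directed_def by blast
      then show ?thesis using xG l closed(3) unfolding eventually_tails[OF r] by (metis FieldI2)
    qed
    fix V assume "V \<in> dual_base F G"
    then obtain P e where V: "V = dual_ball G P e" "finite P" "0 < e"
      and P: "\<And>f u. (f, u) \<in> P \<Longrightarrow> order_continuous_functional F f \<and> u \<in> F \<and> 0 \<le> u"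
      unfolding dual_base_def by blast
    have "eventually (\<lambda>a. \<forall>p\<in>P. small_on (fst p) (inf \<bar>x a - l\<bar> (snd p)) e) (tails r)"
      by (rule eventually_ball_finite[OF V(2)])
        (use P uo_conv_small_on[OF F(1) _ _ _ V(3) reg x] in auto)
    then show "eventually (\<lambda>a. x a - l \<in> V) (tails r)"
      using ev by eventually_elim (auto simp: V dual_ball_def)
  qed
  ultimately show ?thesis
    using locally_solid_base_topology
    unfolding Hausdorff_uo_Lebesgue_topology_def uo_Lebesgue_topology_def by blast
qed

theorem theorem8p1:
  fixes F G :: "'a::archimedean_vector_lattice set"
  assumes "countable_sup_property (UNIV :: 'a set)"
    and "order_ideal F" and "order_dense F" and "oc_dual_separates_points F"
    and "regular_sublattice G"
  shows "\<exists>\<tau>. Hausdorff_uo_Lebesgue_topology G \<tau> \<and>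
      (\<forall>\<tau>'. Hausdorff_uo_Lebesgue_topology G \<tau>' \<longrightarrow> \<tau>' = \<tau>) \<and>
      (\<forall>A. A \<subseteq> G \<longrightarrow>
         seq_adh \<tau> A = \<tau> closure_of A \<and>
         seq_topology \<tau> closure_of A = \<tau> closure_of A \<and>
         suo_adh G A = \<tau> closure_of A \<and>
         suo_topology G closure_of A = \<tau> closure_of A \<and>
         uo_adh G A = \<tau> closure_of A \<and>
         uo_topology G closure_of A = \<tau> closure_of A) \<and>
      seq_topology \<tau> = \<tau> \<and> suo_topology G = \<tau> \<and> uo_topology G = \<tau>"
proof -
  have reg: "regular_sublattice G" by fact
  have G: "vector_sublattice G" using reg by (simp add: regular_sublattice_def)
  have csp: "countable_sup_property G"
    by (rule countable_sup_property_regular_sublattice[OF assms(1) reg])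
  have loc: "Hausdorff_uo_Lebesgue_sublattice G \<tau>" if "Hausdorff_uo_Lebesgue_topology G \<tau>" for \<tau>
    using that G csp by (simp add: Hausdorff_uo_Lebesgue_topology_def
        Hausdorff_uo_Lebesgue_sublattice_def Hausdorff_uo_Lebesgue_sublattice_axioms_def
        uo_Lebesgue_sublattice_def)
  obtain \<tau> where \<tau>: "Hausdorff_uo_Lebesgue_topology G \<tau>"
    using Hausdorff_uo_Lebesgue_topology_exists[OF assms(2-5)] by blast
  interpret Hausdorff_uo_Lebesgue_sublattice G \<tau> by (rule loc[OF \<tau>])
  \<comment> \<open>Any two candidates coincide with \<open>uo_topology G\<close>.\<close>
  have unique: "\<tau>' = \<tau>" if "Hausdorff_uo_Lebesgue_topology G \<tau>'" for \<tau>'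
    using Hausdorff_uo_Lebesgue_sublattice.adh_topologies_eq(2)[OF loc[OF that]] adh_topologies_eq(2)
    by simp
  show ?thesis
    by (intro exI[of _ \<tau>] conjI allI impI)
      (simp_all only: \<tau> unique adh_topologies_eq adh_eq_closure_of)
qed

end
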